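(* Let $G$ be any probability measure on $[0,\infty)$. Then there exists a convex, deterministic function $\Lambda:[0,\infty)\to[0,\infty)$, depending on $G$, such that for every $v\ge 0$, \[\Lambda(v)=\lim_{n\to\infty}\frac1n T((0,0),(n,\lceil vn\rceil))\] almost surely and in $L^1$.
   Context: Model: Let $G$ be a probability measure on $[0,\infty)$. In the nearest-neighbour lattice $\mathbb Z^2$, every vertical edge (joining $(x,y)$ and $(x,y+1)$) receives the deterministic weight $\tau_e=1$, and every horizontal edge (joining $(x,y)$ and $(x+1,y)$) receives a random weight $\tau_e$, the horizontal weights being independent with law $G$. A path is a sequence $p=(z_0,z_1,\dots)$ of points of $\mathbb Z^2$ with $z_k,z_{k+1}$ joined by an edge; an edge $e$ lies in $p$ if $e=(z_k,z_{k+1})$ for some $k$. The passage time is $T(p)=\sum_{e\in p}\tau_e$, and for $u,w\in\mathbb Z^2$, $T(u,w)=\inf_p T(p)$ over all paths from $u$ to $w$. $\lceil a\rceil$ is the smallest integer $\ge a$. *)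

theory Defs
  imports "HOL-Probability.Probability"
begin

type_synonym pt = "int \<times> int"

definition adjacent :: "pt \<Rightarrow> pt \<Rightarrow> bool" where
  "adjacent a b \<longleftrightarrow> \<bar>fst a - fst b\<bar> + \<bar>snd a - snd b\<bar> = 1"

text \<open>An (undirected) edge is encoded by its lower/left endpoint and a flag:
  True = horizontal edge from (x,y) to (x+1,y); False = vertical edge from (x,y) to (x,y+1).\<close>
definition lat_edge :: "pt \<Rightarrow> pt \<Rightarrow> pt \<times> bool" where
  "lat_edge a b = (if snd a = snd b then ((min (fst a) (fst b), snd a), True)
                  else ((fst a, min (snd a) (snd b)), False))"

definition is_path :: "pt list \<Rightarrow> pt \<Rightarrow> pt \<Rightarrow> bool" where
  "is_path p u w \<longleftrightarrow> p \<noteq> [] \<and> hd p = u \<and> last p = w \<and>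
     (\<forall>k. Suc k < length p \<longrightarrow> adjacent (p ! k) (p ! Suc k))"

definition path_edges :: "pt list \<Rightarrow> (pt \<times> bool) set" where
  "path_edges p = {lat_edge (p ! k) (p ! Suc k) | k. Suc k < length p}"

definition edge_weight :: "(pt \<Rightarrow> 'a \<Rightarrow> real) \<Rightarrow> 'a \<Rightarrow> pt \<times> bool \<Rightarrow> real" where
  "edge_weight \<tau> \<omega> e = (if snd e then \<tau> (fst e) \<omega> else 1)"

definition path_time :: "(pt \<Rightarrow> 'a \<Rightarrow> real) \<Rightarrow> 'a \<Rightarrow> pt list \<Rightarrow> real" where
  "path_time \<tau> \<omega> p = (\<Sum>e\<in>path_edges p. edge_weight \<tau> \<omega> e)"

text \<open>Passage time, as an infimum in the extended reals (always defined).\<close>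
definition passage_time :: "(pt \<Rightarrow> 'a \<Rightarrow> real) \<Rightarrow> 'a \<Rightarrow> pt \<Rightarrow> pt \<Rightarrow> ereal" where
  "passage_time \<tau> \<omega> u w = (INF p\<in>{p. is_path p u w}. ereal (path_time \<tau> \<omega> p))"

end

theory Submission
  imports Defs "HOL-Library.Discrete_Functions" "HOL-Real_Asymp.Real_Asymp"
begin

text \<open>
  Since vertical edges cost 1 per step, stepping backwards horizontally never pays, so the passage
  time to \<open>(n, m)\<close> equals a directed column-by-column minimum, \<open>crossing_time\<close>. It is
  nondecreasing in \<open>n\<close>, 1-Lipschitz in \<open>m\<close> and subadditive, so Fekete's lemma applied to its mean
  gives the limit, and subadditivity across two slopes gives convexity.

  Compared with the column in which all weights are 0, the true weights of one column raise the
  crossing time at most by the cost of a vertical detour to a cheap edge, taken at a height that is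
  independent of that column. This detour cost has a finite second moment for every \<open>G\<close>, so the
  Efron--Stein inequality over columns bounds the variance by a constant times \<open>n\<close>. This yields
  \<open>L\<^sup>1\<close> convergence at once, and almost sure convergence first along the squares \<open>n = k\<^sup>2\<close>;
  monotonicity and the Lipschitz property then fill the gaps.
\<close>

section \<open>Directed crossing times\<close>

text \<open>For irrational \<open>v\<close> the endpoints do not advance by a fixed lattice vector,
  so the passage times along them do not form a stationary subadditive array, and an ergodic theorem
  does not apply directly. Concentration takes its place. A variance of order n leaves second
  moments of order 1/n after normalisation: enough in mean, but not summable; along n = k^2 the
  order is 1/k^2, which is. The limit may depend on G only, so means and variances are computed in a
  concrete product space and transported to given weights afterwards. Its independent coordinates
  are whole columns: a directed crossing up to abscissa n reads just n of them, although infinitely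
  many edges are available. As G may have no finite moment, single weights have no useful influence
  bound; a column has one, because some weight level has positive probability and an edge below it
  is found after a geometric number of vertical steps.\<close>

text \<open>Absolute values keep the infima bounded below on the null set where some weight is negative.\<close>

primrec crossing_time :: "(nat \<Rightarrow> int \<Rightarrow> real) \<Rightarrow> nat \<Rightarrow> int \<Rightarrow> real" where
  "crossing_time C 0 m = real_of_int \<bar>m\<bar>"
| "crossing_time C (Suc n) m = (INF y. crossing_time C n y + \<bar>C n y\<bar> + real_of_int \<bar>m - y\<bar>)"

declare crossing_time.simps(2) [simp del]

text \<open>Extra cost of replacing a free crossing at height \<open>z\<close> by a real one: the
  factor 2 pays for the vertical way to \<open>y\<close> and back.\<close>

definition detour_cost :: "(int \<Rightarrow> real) \<Rightarrow> int \<Rightarrow> real" where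
  "detour_cost c z = (INF y. \<bar>c y\<bar> + 2 * real_of_int \<bar>y - z\<bar>)"

lemma crossing_time_nonneg: "0 \<le> crossing_time C n m"
proof (induction n arbitrary: m)
  case (Suc n)
  show ?case by (auto simp: crossing_time.simps(2) intro!: cINF_greatest add_nonneg_nonneg Suc.IH)
qed simp

lemma bdd_below_crossing_time_Suc:
  "bdd_below (range (\<lambda>y. crossing_time C n y + \<bar>C n y\<bar> + real_of_int \<bar>m - y\<bar>))"
  by (rule bdd_belowI[of _ 0]) (auto intro!: add_nonneg_nonneg crossing_time_nonneg)

lemma crossing_time_Suc_le:
  "crossing_time C (Suc n) m \<le> crossing_time C n y + \<bar>C n y\<bar> + real_of_int \<bar>m - y\<bar>"
  unfolding crossing_time.simps by (rule cINF_lower[OF bdd_below_crossing_time_Suc]) simp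

lemma crossing_time_Suc_near_optimal:
  assumes "\<epsilon> > 0"
  obtains y where
    "crossing_time C n y + \<bar>C n y\<bar> + real_of_int \<bar>m - y\<bar> < crossing_time C (Suc n) m + \<epsilon>"
proof -
  have "(INF y. crossing_time C n y + \<bar>C n y\<bar> + real_of_int \<bar>m - y\<bar>)
      < crossing_time C (Suc n) m + \<epsilon>"
    using assms by (simp add: crossing_time.simps(2))
  then show thesis
    using that by (subst (asm) cINF_less_iff[OF _ bdd_below_crossing_time_Suc]) auto
qed

text \<open>The last stretch of a directed route is vertical, so moving its end from
  \<open>m'\<close> to \<open>m\<close> costs at most their distance; the recursion gives this
  without induction.\<close>

lemma crossing_time_lipschitz:
  "crossing_time C n m \<le> crossing_time C n m' + real_of_int \<bar>m - m'\<bar>"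
proof (cases n)
  case (Suc k)
  have "crossing_time C (Suc k) m - real_of_int \<bar>m - m'\<bar> \<le> crossing_time C (Suc k) m'"
    unfolding crossing_time.simps(2)[of C k m']
  proof (rule cINF_greatest)
    fix y
    have "crossing_time C (Suc k) m \<le> crossing_time C k y + \<bar>C k y\<bar> + real_of_int \<bar>m - y\<bar>"
      by (rule crossing_time_Suc_le)
    then show "crossing_time C (Suc k) m - real_of_int \<bar>m - m'\<bar>
        \<le> crossing_time C k y + \<bar>C k y\<bar> + real_of_int \<bar>m' - y\<bar>"
      by linarith
  qed simp
  then show ?thesis unfolding Suc by linarith
qed auto

text \<open>Leaving out the last column replaces a crossing at height \<open>y\<close> by a vertical
  move, which the Lipschitz bound prices at |m - y|. This is what makes leftward steps
  unprofitable.\<close>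

lemma crossing_time_mono_Suc: "crossing_time C n m \<le> crossing_time C (Suc n) m"
  unfolding crossing_time.simps(2)
proof (rule cINF_greatest)
  fix y
  show "crossing_time C n m \<le> crossing_time C n y + \<bar>C n y\<bar> + real_of_int \<bar>m - y\<bar>"
    using crossing_time_lipschitz[of C n m y] by linarith
qed simp

lemma crossing_time_mono: "n \<le> n' \<Longrightarrow> crossing_time C n m \<le> crossing_time C n' m"
  by (rule lift_Suc_mono_le[of "\<lambda>n. crossing_time C n m"]) (auto intro: crossing_time_mono_Suc)

lemma crossing_time_cong:
  "(\<And>i. i < n \<Longrightarrow> C i = C' i) \<Longrightarrow> crossing_time C n m = crossing_time C' n m"
  by (induction n arbitrary: m) (auto simp: crossing_time.simps(2))

text \<open>A route to (n, m) is continued by a route through the environment seen from (n, m). The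
  induction runs over the last column of the second route.\<close>

lemma crossing_time_subadditive:
  "crossing_time C (n + k) (m + l)
     \<le> crossing_time C n m + crossing_time (\<lambda>i y. C (n + i) (m + y)) k l"
proof (induction k arbitrary: l)
  case 0
  then show ?case using crossing_time_lipschitz[of C n "m + l" m] by simp
next
  case (Suc k)
  let ?C = "\<lambda>i y. C (n + i) (m + y)"
  have "crossing_time C (Suc (n + k)) (m + l) - crossing_time C n m \<le> crossing_time ?C (Suc k) l"
    unfolding crossing_time.simps(2)[of ?C]
  proof (rule cINF_greatest)
    fix y
    show "crossing_time C (Suc (n + k)) (m + l) - crossing_time C n m
        \<le> crossing_time ?C k y + \<bar>C (n + k) (m + y)\<bar> + real_of_int \<bar>l - y\<bar>"
      using crossing_time_Suc_le[of C "n + k" "m + l" "m + y"] Suc.IH[of y] by simp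
  qed simp
  then show ?case by simp
qed

lemma crossing_time_zero_column_le:
  "crossing_time (C(i := (\<lambda>_. 0))) n m \<le> crossing_time C n m"
proof (induction n arbitrary: m)
  case (Suc n)
  let ?C = "C(i := (\<lambda>_. 0))"
  show ?case unfolding crossing_time.simps(2)[of C]
  proof (rule cINF_greatest)
    fix y
    show "crossing_time ?C (Suc n) m \<le> crossing_time C n y + \<bar>C n y\<bar> + real_of_int \<bar>m - y\<bar>"
      using crossing_time_Suc_le[of ?C n m y] Suc.IH[of y] abs_ge_zero[of "C n y"]
      by (cases "n = i") (auto simp del: fun_upd_apply simp: fun_upd_same fun_upd_other)
  qed simp
qed simp

section \<open>Detours within a single column\<close>

lemma detour_cost_nonneg: "0 \<le> detour_cost c z"
  unfolding detour_cost_def by (rule cINF_greatest) auto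

lemma detour_cost_le: "detour_cost c z \<le> \<bar>c y\<bar> + 2 * real_of_int \<bar>y - z\<bar>"
  unfolding detour_cost_def by (rule cINF_lower) (auto intro!: bdd_belowI[of _ 0])

text \<open>Reach (n, m), make the detour, return to height \<open>m\<close>. This turns a moment
  bound for one column into integrability for any number of columns.\<close>

lemma crossing_time_Suc_le_detour_cost:
  "crossing_time C (Suc n) m \<le> crossing_time C n m + detour_cost (C n) m"
proof -
  have "crossing_time C (Suc n) m - crossing_time C n m \<le> detour_cost (C n) m"
    unfolding detour_cost_def
  proof (rule cINF_greatest)
    fix y
    show "crossing_time C (Suc n) m - crossing_time C n m \<le> \<bar>C n y\<bar> + 2 * real_of_int \<bar>y - m\<bar>"
      using crossing_time_Suc_le[of C n m y] crossing_time_lipschitz[of C n y m]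
      by (simp add: abs_minus_commute)
  qed simp
  then show ?thesis by linarith
qed

text \<open>The height \<open>z\<close> at which column \<open>i\<close> is crossed does not depend on the
  contents \<open>c\<close> of that column, hence is independent of it in the random model.\<close>

lemma crossing_time_column_le_detour_cost:
  assumes "\<epsilon> > 0"
  shows "\<exists>z. \<forall>c. crossing_time (C(i := c)) n m
           \<le> crossing_time (C(i := (\<lambda>_. 0))) n m + detour_cost c z + \<epsilon>"
  using assms
proof (induction n arbitrary: m \<epsilon>)
  case 0
  then show ?case by (auto intro!: exI[of _ 0] add_nonneg_nonneg detour_cost_nonneg)
next
  case (Suc n)
  let ?C = "C(i := (\<lambda>_. 0))"
  \<comment> \<open>A nearly optimal height for crossing column \<open>n\<close> when column
    \<open>i\<close> is zeroed; half of the slack is kept for the induction hypothesis.\<close>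
  obtain y where y: "crossing_time ?C n y + \<bar>?C n y\<bar> + real_of_int \<bar>m - y\<bar>
      < crossing_time ?C (Suc n) m + \<epsilon> / 2"
    using crossing_time_Suc_near_optimal[of "\<epsilon> / 2" ?C n m] Suc.prems by auto
  show ?case
  proof (cases "n = i")
    \<comment> \<open>Column \<open>i\<close> is the last one, so the witness is \<open>y\<close>
      itself: moving the crossing to an edge \<open>y'\<close> adds its weight and at most two
      vertical legs between \<open>y\<close> and \<open>y'\<close>.\<close>
    case True
    have same: "crossing_time (C(i := c)) n y' = crossing_time ?C n y'" for c y'
      by (rule crossing_time_cong) (simp add: True)
    have "crossing_time (C(i := c)) (Suc n) m
        \<le> crossing_time ?C (Suc n) m + detour_cost c y + \<epsilon>" for c
    proof -
      have "crossing_time (C(i := c)) (Suc n) m - crossing_time ?C (Suc n) m - \<epsilon>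
          \<le> detour_cost c y"
        unfolding detour_cost_def
      proof (rule cINF_greatest)
        fix y'
        have "crossing_time (C(i := c)) (Suc n) m
            \<le> crossing_time ?C n y' + \<bar>c y'\<bar> + real_of_int \<bar>m - y'\<bar>"
          using crossing_time_Suc_le[of "C(i := c)" n m y'] same[of c y'] True by simp
        moreover have "crossing_time ?C n y' \<le> crossing_time ?C n y + real_of_int \<bar>y' - y\<bar>"
          by (rule crossing_time_lipschitz)
        moreover have "\<bar>?C n y\<bar> = 0" using True by simp
        ultimately show "crossing_time (C(i := c)) (Suc n) m - crossing_time ?C (Suc n) m - \<epsilon>
            \<le> \<bar>c y'\<bar> + 2 * real_of_int \<bar>y' - y\<bar>"
          using y Suc.prems abs_triangle_ineq[of "real_of_int m - y" "real_of_int y - y'"]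
          by (simp add: abs_minus_commute)
      qed simp
      then show ?thesis by linarith
    qed
    then show ?thesis by blast
  next
    \<comment> \<open>The crossing of column \<open>n\<close> at \<open>y\<close> is common to both
      environments, so only the cost of reaching (n, y) changes.\<close>
    case False
    obtain z where z: "crossing_time (C(i := c)) n y
        \<le> crossing_time ?C n y + detour_cost c z + \<epsilon> / 2" for c
      using Suc.IH[of "\<epsilon> / 2" y] half_gt_zero[OF Suc.prems] by blast
    have "crossing_time (C(i := c)) (Suc n) m
        \<le> crossing_time ?C (Suc n) m + detour_cost c z + \<epsilon>" for c
      using crossing_time_Suc_le[of "C(i := c)" n m y] z[of c] y False
      by simp
    then show ?thesis by blast
  qed
qed

section \<open>Measurability of crossing times and detour costs\<close>

lemma crossing_time_measurable:
  assumes "\<And>i y. i < n \<Longrightarrow> (\<lambda>\<omega>. C \<omega> i y) \<in> borel_measurable M"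
  shows "(\<lambda>\<omega>. crossing_time (C \<omega>) n m) \<in> borel_measurable M"
  using assms
proof (induction n arbitrary: m)
  case (Suc n)
  have [measurable]: "(\<lambda>\<omega>. crossing_time (C \<omega>) n y) \<in> borel_measurable M"
      "(\<lambda>\<omega>. C \<omega> n y) \<in> borel_measurable M" for y
    using Suc by auto
  show ?case unfolding crossing_time.simps by measurable
qed simp

lemma detour_cost_measurable [measurable]:
  assumes [measurable]: "\<And>y. (\<lambda>\<omega>. c \<omega> y) \<in> borel_measurable M"
  shows "(\<lambda>\<omega>. detour_cost (c \<omega>) z) \<in> borel_measurable M"
  unfolding detour_cost_def by measurable

section \<open>Reduction of passage times to crossing times\<close>

lemma path_edges_Nil [simp]: "path_edges [] = {}"
  and path_edges_singleton [simp]: "path_edges [a] = {}"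
  by (auto simp: path_edges_def)

lemma path_edges_Cons_Cons [simp]:
  "path_edges (a # b # p) = insert (lat_edge a b) (path_edges (b # p))"
  unfolding path_edges_def
proof (intro equalityI subsetI)
  fix e assume "e \<in> {lat_edge ((a # b # p) ! k) ((a # b # p) ! Suc k) |k. Suc k < length (a # b # p)}"
  then obtain k where "e = lat_edge ((a # b # p) ! k) ((a # b # p) ! Suc k)" "Suc k < length (a # b # p)"
    by blast
  then show "e \<in> insert (lat_edge a b) {lat_edge ((b # p) ! k) ((b # p) ! Suc k) |k. Suc k < length (b # p)}"
    by (cases k) auto
next
  fix e assume "e \<in> insert (lat_edge a b) {lat_edge ((b # p) ! k) ((b # p) ! Suc k) |k. Suc k < length (b # p)}"
  then consider "e = lat_edge a b"
    | k where "e = lat_edge ((b # p) ! k) ((b # p) ! Suc k)" "Suc k < length (b # p)" by blast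
  then show "e \<in> {lat_edge ((a # b # p) ! k) ((a # b # p) ! Suc k) |k. Suc k < length (a # b # p)}"
  proof cases
    case 1
    then show ?thesis by (intro CollectI exI[of _ 0]) simp
  next
    case 2
    then show ?thesis by (intro CollectI exI[of _ "Suc k"]) simp
  qed
qed

lemma is_path_singleton [simp]: "is_path [a] u w \<longleftrightarrow> a = u \<and> a = w"
  by (auto simp: is_path_def)

lemma is_path_Cons_Cons [simp]:
  "is_path (a # b # p) u w \<longleftrightarrow> a = u \<and> adjacent a b \<and> is_path (b # p) b w"
proof -
  have "(\<forall>k. Suc k < length (a # b # p) \<longrightarrow> adjacent ((a # b # p) ! k) ((a # b # p) ! Suc k))
     \<longleftrightarrow> adjacent a b \<and> (\<forall>k. Suc k < length (b # p) \<longrightarrow> adjacent ((b # p) ! k) ((b # p) ! Suc k))"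
    (is "?L \<longleftrightarrow> ?R")
  proof
    assume L: ?L
    show ?R using L[rule_format, of 0] L[rule_format, of "Suc _"] by auto
  next
    assume R: ?R
    show ?L
    proof (intro allI impI)
      fix k assume "Suc k < length (a # b # p)"
      then show "adjacent ((a # b # p) ! k) ((a # b # p) ! Suc k)"
        using R by (cases k) auto
    qed
  qed
  then show ?thesis unfolding is_path_def by auto
qed

lemma finite_path_edges [simp]: "finite (path_edges p)"
  by (induction p rule: induct_list012) auto

lemma is_path_append:
  "is_path p u v \<Longrightarrow> is_path (v # q) v w \<Longrightarrow> is_path (p @ q) u w"
proof (induction p arbitrary: u rule: induct_list012)
  case 1
  then show ?case by (simp add: is_path_def)
qed auto

lemma path_edges_append:
  "is_path p u v \<Longrightarrow> path_edges (p @ q) = path_edges p \<union> path_edges (v # q)"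
proof (induction p arbitrary: u rule: induct_list012)
  case 1
  then show ?case by (simp add: is_path_def)
qed auto

lemma lat_edge_endpoint:
  assumes "lat_edge a b = lat_edge c d" "adjacent a b" "adjacent c d"
  shows "a = c \<or> a = d"
proof -
  \<comment> \<open>Decodes an edge into its two endpoints, which shows that the code determines the
    unordered pair.\<close>
  define ends :: "pt \<times> bool \<Rightarrow> pt set" where
    "ends = (\<lambda>((x, y), h). {(x, y), if h then (x + 1, y) else (x, y + 1)})"
  have "ends (lat_edge u w) = {u, w}" if "adjacent u w" for u w
  proof -
    obtain x y x' y' where uw: "u = (x, y)" "w = (x', y')" by fastforce
    from that consider "y' = y" "x' = x + 1" | "y' = y" "x = x' + 1"
      | "x' = x" "y' = y + 1" | "x' = x" "y = y' + 1"
      unfolding adjacent_def uw fst_conv snd_conv by linarith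
    then show ?thesis by cases (auto simp: uw lat_edge_def ends_def)
  qed
  then have "{a, b} = {c, d}" using assms by metis
  then show ?thesis by blast
qed

text \<open>Used contrapositively: an edge at a vertex that the path avoids is not an edge of the
  path.\<close>

lemma lat_edge_in_path_edges:
  assumes "lat_edge a b \<in> path_edges p" "adjacent a b" "is_path p u w"
  shows "a \<in> set p"
proof -
  obtain k where k: "Suc k < length p" "lat_edge a b = lat_edge (p ! k) (p ! Suc k)"
    using assms(1) by (auto simp: path_edges_def)
  then have "a = p ! k \<or> a = p ! Suc k"
    using lat_edge_endpoint assms(2,3) by (metis is_path_def)
  then show ?thesis using k(1) by auto
qed

lemma is_path_suffix:
  "is_path (xs @ c # zs) a w \<Longrightarrow>
     is_path (c # zs) c w \<and> path_edges (c # zs) \<subseteq> path_edges (xs @ c # zs)"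
proof (induction xs arbitrary: a)
  case Nil
  then show ?case by (auto simp: is_path_def)
next
  case (Cons x xs)
  then show ?case by (cases xs) auto
qed

text \<open>Summing \<open>step\<close> along the path is not enough, since \<open>path_time\<close>
  counts a repeated edge only once. Loops are therefore erased on the way, which cannot raise the
  time because weights are nonnegative.\<close>

lemma potential_le_path_time:
  fixes \<phi> :: "pt \<Rightarrow> real"
  assumes nonneg: "\<And>z. 0 \<le> \<tau> z \<omega>"
    and step: "\<And>a b. adjacent a b \<Longrightarrow> \<phi> b \<le> \<phi> a + edge_weight \<tau> \<omega> (lat_edge a b)"
    and "is_path p u w"
  shows "\<phi> w \<le> \<phi> u + path_time \<tau> \<omega> p"
  using assms(3)
proof (induction p arbitrary: u rule: length_induct)
  case (1 p)
  have wt: "0 \<le> edge_weight \<tau> \<omega> e" for e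
    by (simp add: edge_weight_def nonneg)
  consider a where "p = [a]" | a b q where "p = a # b # q"
    using "1.prems" by (metis is_path_def list.exhaust)
  then show ?case
  proof cases
    case 1
    then have "u = w" using "1.prems" by auto
    then show ?thesis using 1 by (simp add: path_time_def)
  next
    case (2 a b q)
    show ?thesis
    proof (cases "a \<in> set (b # q)")
      \<comment> \<open>The start is visited again: drop the loop and continue from the later visit
        with a shorter path.\<close>
      case True
      then obtain ys zs where dec: "b # q = ys @ a # zs" by (meson split_list)
      have "is_path (ys @ a # zs) b w" "a = u" using "1.prems"[unfolded 2 is_path_Cons_Cons] unfolding dec by blast+
      then have "is_path (a # zs) u w" "path_edges (a # zs) \<subseteq> path_edges (b # q)"
        using is_path_suffix[of ys a zs b w] dec by auto
      moreover have "length (a # zs) < length p"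
        using dec 2 by (metis length_Cons length_append less_Suc_eq_le le_add2)
      ultimately have "\<phi> w \<le> \<phi> u + path_time \<tau> \<omega> (a # zs)"
        using "1.IH" by blast
      moreover have "path_time \<tau> \<omega> (a # zs) \<le> path_time \<tau> \<omega> p"
        unfolding path_time_def using \<open>path_edges (a # zs) \<subseteq> path_edges (b # q)\<close> 2
        by (intro sum_mono2 wt) auto
      ultimately show ?thesis by linarith
    next
      \<comment> \<open>The start is never revisited, so the first edge is new and its weight is
        really added.\<close>
      case False
      have "adjacent a b" "is_path (b # q) b w" "a = u" using 2 "1.prems" by auto
      then have "lat_edge a b \<notin> path_edges (b # q)"
        using lat_edge_in_path_edges False by blast
      then have "path_time \<tau> \<omega> p = edge_weight \<tau> \<omega> (lat_edge a b) + path_time \<tau> \<omega> (b # q)"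
        by (simp add: path_time_def 2)
      moreover have "\<phi> w \<le> \<phi> b + path_time \<tau> \<omega> (b # q)"
        using "1.IH"[rule_format, of "b # q" b] 2 \<open>is_path (b # q) b w\<close> by simp
      ultimately show ?thesis using step[OF \<open>adjacent a b\<close>] unfolding \<open>a = u\<close> by linarith
    qed
  qed
qed

lemma crossing_time_le_path_time:
  assumes nonneg: "\<And>z. 0 \<le> \<tau> z \<omega>" and "is_path p (0, 0) (int n, m)"
  shows "crossing_time (\<lambda>i y. \<tau> (int i, y) \<omega>) n m \<le> path_time \<tau> \<omega> p"
proof -
  let ?C = "\<lambda>i y. \<tau> (int i, y) \<omega>"
  \<comment> \<open>The potential is the crossing time itself; \<open>nat\<close> gives every point
    with negative abscissa the value |y|, so excursions to the left of the origin gain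
    nothing.\<close>
  define \<phi> where "\<phi> = (\<lambda>z. crossing_time ?C (nat (fst z)) (snd z))"
  have right: "\<phi> (x + 1, y) \<le> \<phi> (x, y) + \<tau> (x, y) \<omega>" for x y
  proof (cases "x \<ge> 0")
    case True
    then have "nat (x + 1) = Suc (nat x)" by simp
    then show ?thesis using crossing_time_Suc_le[of ?C "nat x" y y] True nonneg[of "(x, y)"]
      by (simp add: \<phi>_def)
  next
    case False
    then show ?thesis using nonneg[of "(x, y)"] by (simp add: \<phi>_def)
  qed
  \<comment> \<open>A left step does not raise the potential, by monotonicity in the number of
    columns.\<close>
  have left: "\<phi> (x, y) \<le> \<phi> (x + 1, y) + \<tau> (x, y) \<omega>" for x y
    using crossing_time_mono[of "nat x" "nat (x + 1)" ?C y] nonneg[of "(x, y)"]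
    by (simp add: \<phi>_def nat_mono)
  have "\<phi> b \<le> \<phi> a + edge_weight \<tau> \<omega> (lat_edge a b)" if "adjacent a b" for a b
  proof -
    obtain x y x' y' where ab: "a = (x, y)" "b = (x', y')" by fastforce
    from that consider "y = y'" "x' = x + 1" | "y = y'" "x = x' + 1" | "x = x'" "\<bar>y' - y\<bar> = 1"
      unfolding adjacent_def ab fst_conv snd_conv by linarith
    then show ?thesis
    proof cases
      case 1
      then show ?thesis using right[of x y] by (simp add: ab lat_edge_def edge_weight_def)
    next
      case 2
      then show ?thesis using left[of x' y] by (simp add: ab lat_edge_def edge_weight_def)
    next
      case 3
      have "\<phi> b \<le> \<phi> a + real_of_int \<bar>y' - y\<bar>"
        unfolding \<phi>_def ab fst_conv snd_conv \<open>x = x'\<close> by (rule crossing_time_lipschitz)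
      then show ?thesis using 3 by (auto simp add: ab lat_edge_def edge_weight_def)
    qed
  qed
  from potential_le_path_time[where \<phi> = \<phi>, OF nonneg this assms(2)] show ?thesis
    by (simp add: \<phi>_def)
qed

section \<open>Upper bound by concatenating paths\<close>

lemma passage_time_triangle:
  assumes nonneg: "\<And>z. 0 \<le> \<tau> z \<omega>"
    and uv: "passage_time \<tau> \<omega> u v < ereal a" and vw: "passage_time \<tau> \<omega> v w < ereal b"
  shows "passage_time \<tau> \<omega> u w < ereal (a + b)"
proof -
  obtain p where p: "is_path p u v" "path_time \<tau> \<omega> p < a"
    using uv by (auto simp: passage_time_def INF_less_iff)
  obtain q' where q': "is_path q' v w" "path_time \<tau> \<omega> q' < b"
    using vw by (auto simp: passage_time_def INF_less_iff)
  then obtain q where q: "q' = v # q" by (metis is_path_def list.exhaust_sel)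
  \<comment> \<open>Edges shared by both paths are counted once in the union, so the sum can only
    drop.\<close>
  have "path_time \<tau> \<omega> (p @ q) \<le> path_time \<tau> \<omega> p + path_time \<tau> \<omega> q'"
    unfolding path_time_def path_edges_append[OF p(1)] q
    by (subst sum.union_inter [symmetric]) (auto simp: edge_weight_def nonneg intro!: sum_nonneg)
  moreover have "is_path (p @ q) u w" using is_path_append p(1) q'(1) q by blast
  ultimately show ?thesis using p(2) q'(2)
    by (auto simp: passage_time_def INF_less_iff intro!: bexI[of _ "p @ q"])
qed

lemma passage_time_le_edge:
  assumes "adjacent a b"
  shows "passage_time \<tau> \<omega> a b \<le> ereal (edge_weight \<tau> \<omega> (lat_edge a b))"
proof -
  have "path_time \<tau> \<omega> [a, b] = edge_weight \<tau> \<omega> (lat_edge a b)" by (simp add: path_time_def)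
  moreover have "is_path [a, b] a b" using assms by simp
  ultimately show ?thesis unfolding passage_time_def by (metis INF_lower mem_Collect_eq)
qed

lemma passage_time_vertical_less:
  assumes nonneg: "\<And>z. 0 \<le> \<tau> z \<omega>" and "\<epsilon> > 0"
  shows "passage_time \<tau> \<omega> (x, y) (x, y') < ereal (real_of_int \<bar>y' - y\<bar> + \<epsilon>)"
  using \<open>\<epsilon> > 0\<close>
proof (induction "nat \<bar>y' - y\<bar>" arbitrary: y \<epsilon>)
  case 0
  then have "is_path [(x, y)] (x, y) (x, y')" "path_time \<tau> \<omega> [(x, y)] = 0"
    by (auto simp: path_time_def)
  then have "passage_time \<tau> \<omega> (x, y) (x, y') \<le> ereal 0"
    unfolding passage_time_def by (metis INF_lower mem_Collect_eq)
  also have "\<dots> < ereal (real_of_int \<bar>y' - y\<bar> + \<epsilon>)" using 0 by simp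
  finally show ?case .
next
  case (Suc k)
  define y1 where "y1 = (if y < y' then y + 1 else y - 1)"
  have y1: "nat \<bar>y' - y1\<bar> = k" "adjacent (x, y) (x, y1)" "y \<noteq> y1"
      "\<bar>y' - y\<bar> = 1 + \<bar>y' - y1\<bar>"
    using Suc.hyps(2) by (auto simp: y1_def adjacent_def)
  have "passage_time \<tau> \<omega> (x, y) (x, y1) \<le> ereal 1"
    using passage_time_le_edge[OF y1(2), of \<tau> \<omega>] y1(3) by (simp add: lat_edge_def edge_weight_def)
  also have "\<dots> < ereal (1 + \<epsilon> / 2)" using Suc.prems by simp
  finally have "passage_time \<tau> \<omega> (x, y) (x, y')
      < ereal ((1 + \<epsilon> / 2) + (real_of_int \<bar>y' - y1\<bar> + \<epsilon> / 2))"
    using Suc.hyps(1)[of y1 "\<epsilon> / 2"] half_gt_zero[OF Suc.prems] y1(1)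
    by (intro passage_time_triangle[where \<tau> = \<tau> and \<omega> = \<omega> and v = "(x, y1)"
          and a = "1 + \<epsilon> / 2" and b = "real_of_int \<bar>y' - y1\<bar> + \<epsilon> / 2", OF nonneg]) auto
  also have "(1 + \<epsilon> / 2) + (real_of_int \<bar>y' - y1\<bar> + \<epsilon> / 2) = real_of_int \<bar>y' - y\<bar> + \<epsilon>"
    using y1(4) by simp
  finally show ?case .
qed

lemma passage_time_less_crossing_time:
  assumes nonneg: "\<And>z. 0 \<le> \<tau> z \<omega>" and "\<epsilon> > 0"
  shows "passage_time \<tau> \<omega> (0, 0) (int n, m)
           < ereal (crossing_time (\<lambda>i y. \<tau> (int i, y) \<omega>) n m + \<epsilon>)"
  using \<open>\<epsilon> > 0\<close>
proof (induction n arbitrary: m \<epsilon>)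
  case 0
  then show ?case using passage_time_vertical_less[where \<tau> = \<tau> and \<omega> = \<omega>, OF nonneg, of \<epsilon> 0 0 m] by simp
next
  case (Suc n)
  let ?C = "\<lambda>i y. \<tau> (int i, y) \<omega>"
  \<comment> \<open>Four equal shares of the slack: one for the choice of \<open>y\<close>, one each
    for the way to (n, y), the horizontal edge and the final vertical run.\<close>
  obtain y where y: "crossing_time ?C n y + \<bar>\<tau> (int n, y) \<omega>\<bar> + real_of_int \<bar>m - y\<bar>
      < crossing_time ?C (Suc n) m + \<epsilon> / 4"
    using crossing_time_Suc_near_optimal[of "\<epsilon> / 4" ?C n m] Suc.prems by auto
  have adj: "adjacent (int n, y) (int (Suc n), y)" by (simp add: adjacent_def)
  have "passage_time \<tau> \<omega> (int n, y) (int (Suc n), y) \<le> ereal \<bar>\<tau> (int n, y) \<omega>\<bar>"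
    using passage_time_le_edge[OF adj, of \<tau> \<omega>] nonneg
    by (simp add: lat_edge_def edge_weight_def)
  also have "\<dots> < ereal (\<bar>\<tau> (int n, y) \<omega>\<bar> + \<epsilon> / 4)" using Suc.prems by simp
  finally have edge: "passage_time \<tau> \<omega> (int n, y) (int (Suc n), y)
      < ereal (\<bar>\<tau> (int n, y) \<omega>\<bar> + \<epsilon> / 4)" .
  have "passage_time \<tau> \<omega> (0, 0) (int (Suc n), m)
      < ereal (((crossing_time ?C n y + \<epsilon> / 4) + (\<bar>\<tau> (int n, y) \<omega>\<bar> + \<epsilon> / 4))
               + (real_of_int \<bar>m - y\<bar> + \<epsilon> / 4))"
    by (rule passage_time_triangle[where \<tau> = \<tau> and \<omega> = \<omega>, OF nonneg
        passage_time_triangle[where \<tau> = \<tau> and \<omega> = \<omega>, OF nonneg Suc.IH edge]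
        passage_time_vertical_less[where \<tau> = \<tau> and \<omega> = \<omega>, OF nonneg]])
       (use Suc.prems in auto)
  also have "\<dots> < ereal (crossing_time ?C (Suc n) m + \<epsilon>)"
    using y by simp
  finally show ?case .
qed

proposition passage_time_eq_crossing_time:
  assumes nonneg: "\<And>z. 0 \<le> \<tau> z \<omega>"
  shows "passage_time \<tau> \<omega> (0, 0) (int n, m)
           = ereal (crossing_time (\<lambda>i y. \<tau> (int i, y) \<omega>) n m)"
proof (rule antisym)
  show "passage_time \<tau> \<omega> (0, 0) (int n, m) \<le> ereal (crossing_time (\<lambda>i y. \<tau> (int i, y) \<omega>) n m)"
  proof (rule ereal_le_epsilon2)
    fix e :: real assume "0 < e"
    then show "passage_time \<tau> \<omega> (0, 0) (int n, m)
        \<le> ereal (crossing_time (\<lambda>i y. \<tau> (int i, y) \<omega>) n m) + ereal e"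
      using passage_time_less_crossing_time[where \<tau> = \<tau> and \<omega> = \<omega> and \<epsilon> = e and n = n and m = m, OF nonneg]
      by (simp add: less_imp_le)
  qed
  show "ereal (crossing_time (\<lambda>i y. \<tau> (int i, y) \<omega>) n m) \<le> passage_time \<tau> \<omega> (0, 0) (int n, m)"
    unfolding passage_time_def
    using crossing_time_le_path_time[where \<tau> = \<tau> and \<omega> = \<omega>, OF nonneg]
    by (intro INF_greatest) simp
qed

section \<open>Efron--Stein inequality\<close>

lemma (in prob_space) square_lebesgue_integral_le:
  fixes X :: "'a \<Rightarrow> real"
  assumes "integrable M X" "integrable M (\<lambda>x. (X x)\<^sup>2)"
  shows "(expectation X)\<^sup>2 \<le> expectation (\<lambda>x. (X x)\<^sup>2)"
  using variance_eq[OF assms] variance_positive[of X] by simp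

text \<open>The mean minimises the mean square deviation. Below, \<open>c\<close> is a value of
  \<open>g j\<close> with the other coordinates frozen.\<close>

lemma (in prob_space) variance_le_expectation_sq_diff:
  fixes X :: "'a \<Rightarrow> real"
  assumes i: "integrable M X" and i2: "integrable M (\<lambda>x. (X x)\<^sup>2)"
  shows "expectation (\<lambda>x. (X x)\<^sup>2) - (expectation X)\<^sup>2 \<le> expectation (\<lambda>x. (X x - c)\<^sup>2)"
proof -
  have "expectation (\<lambda>x. (X x - c)\<^sup>2) = expectation (\<lambda>x. (X x)\<^sup>2 - 2 * c * X x + c\<^sup>2)"
    by (simp add: power2_diff algebra_simps)
  also have "\<dots> = expectation (\<lambda>x. (X x)\<^sup>2) - 2 * c * expectation X + c\<^sup>2"
    using i i2 by (simp add: prob_space)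
  finally show ?thesis
    using zero_le_power2[of "expectation X - c"] by (simp add: power2_diff algebra_simps)
qed

text \<open>The Efron--Stein inequality, in the form where the conditional variance in the \<open>i\<close>-th
  coordinate is bounded by the squared distance to some function \<open>g i\<close> not depending on it.\<close>

proposition efron_stein:
  fixes M :: "'i \<Rightarrow> 'a measure" and f :: "('i \<Rightarrow> 'a) \<Rightarrow> real" and g :: "'i \<Rightarrow> ('i \<Rightarrow> 'a) \<Rightarrow> real"
  assumes prob: "\<And>i. prob_space (M i)" and "finite I"
    and "f \<in> borel_measurable (Pi\<^sub>M I M)" "\<And>x. x \<in> space (Pi\<^sub>M I M) \<Longrightarrow> \<bar>f x\<bar> \<le> B"
    and "\<And>i. i \<in> I \<Longrightarrow> g i \<in> borel_measurable (Pi\<^sub>M I M)"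
    and "\<And>i x. i \<in> I \<Longrightarrow> x \<in> space (Pi\<^sub>M I M) \<Longrightarrow> \<bar>g i x\<bar> \<le> B"
    and "\<And>i x s t. i \<in> I \<Longrightarrow> x \<in> space (Pi\<^sub>M (I - {i}) M) \<Longrightarrow> s \<in> space (M i) \<Longrightarrow> t \<in> space (M i)
            \<Longrightarrow> g i (x(i := s)) = g i (x(i := t))"
  shows "(\<integral>x. (f x)\<^sup>2 \<partial>Pi\<^sub>M I M) - (\<integral>x. f x \<partial>Pi\<^sub>M I M)\<^sup>2
       \<le> (\<Sum>i\<in>I. \<integral>x. (f x - g i x)\<^sup>2 \<partial>Pi\<^sub>M I M)"
  using assms(2-)
proof (induction I arbitrary: f g rule: finite_induct)
  case empty
  interpret Q: prob_space "Pi\<^sub>M {} M" by (rule prob_space_PiM) (rule prob)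
  \<comment> \<open>The product over no index is a point mass, so the variance vanishes.\<close>
  have "(\<integral>x. h x \<partial>Pi\<^sub>M {} M) = h (\<lambda>_. undefined)" for h :: "('i \<Rightarrow> 'a) \<Rightarrow> real"
  proof -
    have "(\<integral>x. h x \<partial>Pi\<^sub>M {} M) = (\<integral>x. h (\<lambda>_. undefined) \<partial>Pi\<^sub>M {} M)"
      by (intro Bochner_Integration.integral_cong) (auto simp: space_PiM)
    then show ?thesis by (simp add: Q.prob_space)
  qed
  then show ?case by simp
next
  case (insert j I)
  interpret Q: prob_space "Pi\<^sub>M I M" by (rule prob_space_PiM) (rule prob)
  interpret QJ: prob_space "Pi\<^sub>M (insert j I) M" by (rule prob_space_PiM) (rule prob)
  interpret J: prob_space "M j" by (rule prob)
  interpret product_sigma_finite M using prob by (simp add: product_sigma_finite_def prob_space_imp_sigma_finite)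
  note [measurable] = insert.prems(1)
  have gm [measurable]: "i \<in> insert j I \<Longrightarrow> g i \<in> borel_measurable (Pi\<^sub>M (insert j I) M)" for i
    using insert.prems by auto
  have upd: "x(j := t) \<in> space (Pi\<^sub>M (insert j I) M)" if "x \<in> space (Pi\<^sub>M I M)" "t \<in> space (M j)" for x t
    using that by (auto simp: space_PiM PiE_iff extensional_def)
  have upd_meas [measurable]: "(\<lambda>(x, t). h (x(j := t))) \<in> borel_measurable (Pi\<^sub>M I M \<Otimes>\<^sub>M M j)"
    if [measurable]: "h \<in> borel_measurable (Pi\<^sub>M (insert j I) M)" for h :: "_ \<Rightarrow> real"
    using measurable_compose[OF measurable_add_dim that] by (simp add: split_def)
  have upd_meas1 [measurable]: "(\<lambda>t. h (x(j := t))) \<in> borel_measurable (M j)"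
    if "h \<in> borel_measurable (Pi\<^sub>M (insert j I) M)" "x \<in> space (Pi\<^sub>M I M)" for x and h :: "_ \<Rightarrow> real"
    using measurable_compose_Pair1[OF that(2) upd_meas[OF that(1)]] by simp
  \<comment> \<open>The conditional expectation of \<open>h\<close> given the coordinates in
    \<open>I\<close>.\<close>
  define av where "av h x = (\<integral>t. h (x(j := t)) \<partial>M j)" for h :: "_ \<Rightarrow> real" and x
  have av_meas [measurable]: "av h \<in> borel_measurable (Pi\<^sub>M I M)"
    if [measurable]: "h \<in> borel_measurable (Pi\<^sub>M (insert j I) M)" for h
    unfolding av_def
    using J.borel_measurable_lebesgue_integral[of "\<lambda>x t. h (x(j := t))" "Pi\<^sub>M I M"] upd_meas[OF that]
    by simp
  define bdd where "bdd h b \<longleftrightarrow> h \<in> borel_measurable (Pi\<^sub>M (insert j I) M) \<and>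
      (\<forall>x\<in>space (Pi\<^sub>M (insert j I) M). \<bar>h x\<bar> \<le> b)" for h :: "_ \<Rightarrow> real" and b :: real
  have bddJ: "integrable (M j) (\<lambda>t. h (x(j := t)))" if "bdd h b" "x \<in> space (Pi\<^sub>M I M)" for h b x
    using that upd by (intro J.integrable_const_bound[of _ b]) (auto simp: bdd_def)
  have bddP: "integrable (Pi\<^sub>M (insert j I) M) h" if "bdd h b" for h b
    using that by (intro QJ.integrable_const_bound[of _ b]) (auto simp: bdd_def)
  have av_bdd: "\<bar>av h x\<bar> \<le> b" if "bdd h b" "x \<in> space (Pi\<^sub>M I M)" for h b x
  proof -
    have "\<bar>av h x\<bar> \<le> (\<integral>t. \<bar>h (x(j := t))\<bar> \<partial>M j)" unfolding av_def by (rule integral_abs_bound)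
    also have "\<dots> \<le> (\<integral>t. b \<partial>M j)"
      using bddJ[OF that] upd that by (intro integral_mono) (auto simp: bdd_def)
    finally show ?thesis by (simp add: J.prob_space)
  qed
  have av_int: "integrable (Pi\<^sub>M I M) (av h)" if "bdd h b" for h b
    using that av_bdd[OF that] by (intro Q.integrable_const_bound[of _ b]) (auto simp: bdd_def)
  have av_eq: "(\<integral>x. h x \<partial>Pi\<^sub>M (insert j I) M) = (\<integral>x. av h x \<partial>Pi\<^sub>M I M)" if "bdd h b" for h b
    unfolding av_def using product_integral_insert[OF insert.hyps bddP[OF that]] .
  have sq_bdd: "bdd (\<lambda>x. (h x)\<^sup>2) (b\<^sup>2)" if "bdd h b" for h b
    using that by (auto simp: bdd_def abs_le_square_iff[symmetric] intro: order_trans)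
  have f: "bdd f B" using insert.prems(1,2) by (auto simp: bdd_def)
  have g: "bdd (g i) B" if "i \<in> insert j I" for i using insert.prems(3,4) that by (auto simp: bdd_def)
  have fg: "bdd (\<lambda>x. f x - g i x) (2 * B)" if "i \<in> insert j I" for i
    unfolding bdd_def
  proof safe
    show "(\<lambda>x. f x - g i x) \<in> borel_measurable (Pi\<^sub>M (insert j I) M)"
      using gm[OF that] by measurable
    fix x assume x: "x \<in> space (Pi\<^sub>M (insert j I) M)"
    show "\<bar>f x - g i x\<bar> \<le> 2 * B"
      using insert.prems(2)[OF x] insert.prems(4)[OF that x] by linarith
  qed
  \<comment> \<open>Law of total variance: the mean conditional variance in coordinate
    \<open>j\<close>, plus the variance of the conditional mean.\<close>
  have "(\<integral>x. (f x)\<^sup>2 \<partial>Pi\<^sub>M (insert j I) M) - (\<integral>x. f x \<partial>Pi\<^sub>M (insert j I) M)\<^sup>2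
      = (\<integral>x. av (\<lambda>x. (f x)\<^sup>2) x - (av f x)\<^sup>2 \<partial>Pi\<^sub>M I M)
        + ((\<integral>x. (av f x)\<^sup>2 \<partial>Pi\<^sub>M I M) - (\<integral>x. av f x \<partial>Pi\<^sub>M I M)\<^sup>2)"
  proof -
    have "integrable (Pi\<^sub>M I M) (\<lambda>x. (av f x)\<^sup>2)"
      using av_bdd[OF f] by (intro Q.integrable_const_bound[of _ "B\<^sup>2"])
        (auto simp: abs_le_square_iff[symmetric] intro!: AE_I2 order_trans[OF _ abs_ge_self])
    then show ?thesis using av_int[OF sq_bdd[OF f]] by (simp add: av_eq[OF f] av_eq[OF sq_bdd[OF f]])
  qed
  also have "(\<integral>x. av (\<lambda>x. (f x)\<^sup>2) x - (av f x)\<^sup>2 \<partial>Pi\<^sub>M I M) \<le> (\<integral>x. (f x - g j x)\<^sup>2 \<partial>Pi\<^sub>M (insert j I) M)"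
    unfolding av_eq[OF sq_bdd[OF fg[OF insertI1]]]
  proof (rule integral_mono')
    show "integrable (Pi\<^sub>M I M) (av (\<lambda>x. (f x - g j x)\<^sup>2))" by (rule av_int[OF sq_bdd[OF fg]]) simp
    fix x assume x: "x \<in> space (Pi\<^sub>M I M)"
    show "0 \<le> av (\<lambda>x. (f x - g j x)\<^sup>2) x" unfolding av_def by simp
    \<comment> \<open>Since \<open>g j\<close> is constant in coordinate \<open>j\<close>, it may be
      evaluated at any fixed \<open>s\<close> and serves as the constant in the conditional variance
      bound.\<close>
    obtain s where s: "s \<in> space (M j)" using J.not_empty by blast
    have "av (\<lambda>x. (f x)\<^sup>2) x - (av f x)\<^sup>2 \<le> (\<integral>t. (f (x(j := t)) - g j (x(j := s)))\<^sup>2 \<partial>M j)"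
      unfolding av_def using bddJ[OF f x] bddJ[OF sq_bdd[OF f] x]
      by (intro J.variance_le_expectation_sq_diff) auto
    also have "\<dots> = av (\<lambda>x. (f x - g j x)\<^sup>2) x"
      unfolding av_def
    proof (rule Bochner_Integration.integral_cong[OF refl])
      fix t assume "t \<in> space (M j)"
      moreover have "insert j I - {j} = I" using insert.hyps by auto
      ultimately have "g j (x(j := s)) = g j (x(j := t))"
        using insert.prems(5)[of j x s t] x s by (simp del: fun_upd_apply)
      then show "(f (x(j := t)) - g j (x(j := s)))\<^sup>2 = (f (x(j := t)) - g j (x(j := t)))\<^sup>2"
        by simp
    qed
    finally show "av (\<lambda>x. (f x)\<^sup>2) x - (av f x)\<^sup>2 \<le> av (\<lambda>x. (f x - g j x)\<^sup>2) x" .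
  qed
  \<comment> \<open>Averaging over coordinate \<open>j\<close> keeps each \<open>g i\<close>
    constant in coordinate \<open>i\<close>, so the induction hypothesis applies to the averaged
    functions.\<close>
  also have "(\<integral>x. (av f x)\<^sup>2 \<partial>Pi\<^sub>M I M) - (\<integral>x. av f x \<partial>Pi\<^sub>M I M)\<^sup>2
      \<le> (\<Sum>i\<in>I. \<integral>x. (av f x - av (g i) x)\<^sup>2 \<partial>Pi\<^sub>M I M)"
  proof (rule insert.IH)
    fix i assume i: "i \<in> I"
    then have ij: "i \<noteq> j" using insert.hyps by blast
    show "av (g i) \<in> borel_measurable (Pi\<^sub>M I M)" using i by (intro av_meas gm) simp
    show "\<bar>av (g i) x\<bar> \<le> B" if "x \<in> space (Pi\<^sub>M I M)" for x using av_bdd[OF g that] i by simp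
    fix x s t assume x: "x \<in> space (Pi\<^sub>M (I - {i}) M)" and st: "s \<in> space (M i)" "t \<in> space (M i)"
    show "av (g i) (x(i := s)) = av (g i) (x(i := t))"
      unfolding av_def
    proof (rule Bochner_Integration.integral_cong[OF refl])
      fix u assume u: "u \<in> space (M j)"
      have "x(j := u) \<in> space (Pi\<^sub>M (insert j I - {i}) M)"
        using x u ij by (auto simp: space_PiM PiE_iff extensional_def)
      then show "g i (x(i := s, j := u)) = g i (x(i := t, j := u))"
        using insert.prems(5)[of i "x(j := u)" s t] i st
        by (simp add: fun_upd_twist[OF ij] del: fun_upd_apply)
    qed
  qed (use av_bdd[OF f] in \<open>auto intro: av_meas insert.prems\<close>)
  \<comment> \<open>By Jensen, averaging before squaring only decreases the squared
    differences.\<close>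
  also have "\<dots> \<le> (\<Sum>i\<in>I. \<integral>x. (f x - g i x)\<^sup>2 \<partial>Pi\<^sub>M (insert j I) M)"
  proof (rule sum_mono)
    fix i assume "i \<in> I"
    then have i: "i \<in> insert j I" by simp
    show "(\<integral>x. (av f x - av (g i) x)\<^sup>2 \<partial>Pi\<^sub>M I M) \<le> (\<integral>x. (f x - g i x)\<^sup>2 \<partial>Pi\<^sub>M (insert j I) M)"
      unfolding av_eq[OF sq_bdd[OF fg[OF i]]]
    proof (rule integral_mono')
      show "integrable (Pi\<^sub>M I M) (av (\<lambda>x. (f x - g i x)\<^sup>2))" by (rule av_int[OF sq_bdd[OF fg[OF i]]])
      fix x assume x: "x \<in> space (Pi\<^sub>M I M)"
      show "0 \<le> av (\<lambda>x. (f x - g i x)\<^sup>2) x" unfolding av_def by simp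
      have "av f x - av (g i) x = (\<integral>t. f (x(j := t)) - g i (x(j := t)) \<partial>M j)"
        unfolding av_def using bddJ[OF f x] bddJ[OF g[OF i] x] by simp
      then show "(av f x - av (g i) x)\<^sup>2 \<le> av (\<lambda>x. (f x - g i x)\<^sup>2) x"
        using J.square_lebesgue_integral_le[OF bddJ[OF fg[OF i] x] bddJ[OF sq_bdd[OF fg[OF i]] x]]
        by (simp add: av_def)
    qed
  qed
  finally show ?case using insert.hyps by (simp add: add_ac)
qed

section \<open>Subadditive sequences and interpolation\<close>

lemma fekete_subadditive:
  fixes b :: "nat \<Rightarrow> real"
  assumes sub: "\<And>m n. b (m + n) \<le> b m + b n" and nonneg: "\<And>n. 0 \<le> b n"
  shows "convergent (\<lambda>n. b n / real n)"
proof -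
  define L where "L = (INF n\<in>{1..}. b n / real n)"
  have bdd: "bdd_below ((\<lambda>n. b n / real n) ` {1..})"
    by (rule bdd_belowI[of _ 0]) (auto simp: nonneg)
  have "(\<lambda>n. b n / real n) \<longlonglongrightarrow> L"
  proof (rule LIMSEQ_I)
    fix e :: real assume e: "0 < e"
    have "L < L + e / 2" using e by simp
    then obtain N where N: "N \<ge> 1" "b N / real N < L + e / 2"
      unfolding L_def by (subst (asm) cINF_less_iff[OF _ bdd]) auto
    \<comment> \<open>One bound for all remainders of division by \<open>N\<close>.\<close>
    define B where "B = (\<Sum>r<N. b r)"
    have quot: "b (q * N + r) \<le> real q * b N + b r" for q r
    proof (induction q)
      case (Suc q)
      then show ?case using sub[of N "q * N + r"] by (simp add: algebra_simps)
    qed simp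
    have upper: "b n / real n \<le> b N / real N + B / real n" if "n \<ge> 1" for n
    proof -
      have "b (n mod N) \<le> B" unfolding B_def
        using N by (intro member_le_sum) (auto simp: nonneg)
      moreover have "b n \<le> real (n div N) * b N + b (n mod N)"
        using quot[of "n div N" "n mod N"] by simp
      ultimately have "b n \<le> real (n div N) * b N + B" by linarith
      also have "real (n div N) * b N \<le> (real n / real N) * b N"
        by (intro mult_right_mono nonneg) (rule of_nat_div_le_of_nat)
      finally show ?thesis using that by (simp add: field_simps)
    qed
    obtain n0 :: nat where n0: "2 * B / e < real n0" using reals_Archimedean2 by blast
    show "\<exists>no. \<forall>n\<ge>no. norm (b n / real n - L) < e"
    proof (intro exI[of _ "max 1 n0"] allI impI)
      fix n assume n: "max 1 n0 \<le> n"
      have "L \<le> b n / real n" unfolding L_def using n by (intro cINF_lower[OF bdd]) auto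
      moreover have "B / real n < e / 2"
      proof -
        have "2 * B / e < real n" using n0 n by linarith
        then show ?thesis using e n by (simp add: field_simps)
      qed
      moreover have "b n / real n \<le> b N / real N + B / real n" using n by (intro upper) simp
      ultimately show "norm (b n / real n - L) < e" using N(2) unfolding real_norm_def by linarith
    qed
  qed
  then show ?thesis by (auto simp: convergent_def)
qed

text \<open>Between k^2 and (k + 1)^2 the loss is at most v (2 k + 1) + 1, negligible against k^2,
  and the ratio of the two squares tends to 1. So the values at squares pin down the whole
  sequence.\<close>

lemma tendsto_div_of_tendsto_squares:
  fixes s :: "nat \<Rightarrow> real"
  assumes nonneg: "\<And>n. 0 \<le> s n" and v: "0 \<le> v"
    and step: "\<And>n n'. n \<le> n' \<Longrightarrow> s n \<le> s n' + v * (real n' - real n) + 1"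
    and lim: "(\<lambda>k. s (k\<^sup>2) / real (k\<^sup>2)) \<longlonglongrightarrow> L"
  shows "(\<lambda>n. s n / real n) \<longlonglongrightarrow> L"
proof -
  define u where "u k = s ((Suc k)\<^sup>2) / real ((Suc k)\<^sup>2) * (real ((Suc k)\<^sup>2) / real (k\<^sup>2))
      + (v * (2 * real k + 1) + 1) / real (k\<^sup>2)" for k
  define l where "l k = s (k\<^sup>2) / real (k\<^sup>2) * (real (k\<^sup>2) / real ((Suc k)\<^sup>2))
      - (v * (2 * real k + 1) + 1) / real (k\<^sup>2)" for k
  have r1: "(\<lambda>k. real ((Suc k)\<^sup>2) / real (k\<^sup>2)) \<longlonglongrightarrow> 1"
    "(\<lambda>k. real (k\<^sup>2) / real ((Suc k)\<^sup>2)) \<longlonglongrightarrow> 1"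
    "(\<lambda>k. (v * (2 * real k + 1) + 1) / real (k\<^sup>2)) \<longlonglongrightarrow> 0"
    by real_asymp+
  have "u \<longlonglongrightarrow> L * 1 + 0" unfolding u_def
    by (intro tendsto_add tendsto_mult r1 LIMSEQ_Suc[OF lim])
  then have ulim: "u \<longlonglongrightarrow> L" by simp
  have "l \<longlonglongrightarrow> L * 1 - 0" unfolding l_def by (intro tendsto_diff tendsto_mult r1 lim)
  then have llim: "l \<longlonglongrightarrow> L" by simp
  have sq: "filterlim floor_sqrt at_top sequentially"
  proof (rule filterlim_at_top[THEN iffD2], intro allI)
    fix Z
    show "\<forall>\<^sub>F n in sequentially. Z \<le> floor_sqrt n"
      using eventually_ge_at_top[of "Z\<^sup>2"]
      by eventually_elim (metis floor_sqrt_inverse_power2 mono_floor_sqrt')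
  qed
  have bounds: "l (floor_sqrt n) \<le> s n / real n \<and> s n / real n \<le> u (floor_sqrt n)" if "n \<ge> 1" for n
  proof -
    define k where "k = floor_sqrt n"
    have k: "k\<^sup>2 \<le> n" "n < (Suc k)\<^sup>2" "k \<ge> 1"
      using that by (auto simp: k_def Suc_floor_sqrt_power2_gt Suc_le_eq)
    have kr: "real (k\<^sup>2) \<le> real n" "real n \<le> real ((Suc k)\<^sup>2)" "0 < real (k\<^sup>2)" "0 < real n"
      using k that by (auto simp del: of_nat_power)
    have diff: "real ((Suc k)\<^sup>2) - real (k\<^sup>2) = 2 * real k + 1"
      by (simp add: power2_eq_square algebra_simps)
    have c: "v * (real ((Suc k)\<^sup>2) - real n) \<le> v * (2 * real k + 1)"
        "v * (real n - real (k\<^sup>2)) \<le> v * (2 * real k + 1)"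
      using kr diff by (intro mult_left_mono v; linarith)+
    have "s n \<le> s ((Suc k)\<^sup>2) + (v * (2 * real k + 1) + 1)"
      using step[of n "(Suc k)\<^sup>2"] k c(1) by linarith
    then have "s n / real n \<le> (s ((Suc k)\<^sup>2) + (v * (2 * real k + 1) + 1)) / real n"
      using kr by (intro divide_right_mono) auto
    also have "\<dots> \<le> (s ((Suc k)\<^sup>2) + (v * (2 * real k + 1) + 1)) / real (k\<^sup>2)"
      using kr v nonneg[of "(Suc k)\<^sup>2"] by (intro divide_left_mono) auto
    also have "\<dots> = u k" by (simp add: u_def add_divide_distrib)
    finally have U: "s n / real n \<le> u k" .
    have "l k = s (k\<^sup>2) / real ((Suc k)\<^sup>2) - (v * (2 * real k + 1) + 1) / real (k\<^sup>2)"
      using kr(3) by (simp add: l_def)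
    also have "\<dots> \<le> s (k\<^sup>2) / real n - (v * (2 * real k + 1) + 1) / real n"
      using kr v nonneg[of "k\<^sup>2"] by (intro diff_mono divide_left_mono) auto
    also have "\<dots> = (s (k\<^sup>2) - (v * (2 * real k + 1) + 1)) / real n" by (simp add: diff_divide_distrib)
    also have "\<dots> \<le> s n / real n"
      using step[of "k\<^sup>2" n] k c(2) kr by (intro divide_right_mono) auto
    finally show ?thesis using U by (simp add: k_def)
  qed
  show ?thesis
  proof (rule tendsto_sandwich)
    show "(\<lambda>n. l (floor_sqrt n)) \<longlonglongrightarrow> L" by (rule filterlim_compose[OF llim sq])
    show "(\<lambda>n. u (floor_sqrt n)) \<longlonglongrightarrow> L" by (rule filterlim_compose[OF ulim sq])
  qed (use bounds in \<open>auto intro!: eventually_sequentiallyI[of 1]\<close>)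
qed

text \<open>The expected sum of the squares is finite, so almost surely the series of squares
  converges and its terms tend to 0.\<close>

lemma (in prob_space) AE_tendsto_zero_of_summable_second_moments:
  fixes Z :: "nat \<Rightarrow> 'a \<Rightarrow> real"
  assumes "\<And>k. integrable M (\<lambda>\<omega>. (Z k \<omega>)\<^sup>2)" and le: "\<And>k. expectation (\<lambda>\<omega>. (Z k \<omega>)\<^sup>2) \<le> c k"
    and "summable c"
  shows "AE \<omega> in M. (\<lambda>k. Z k \<omega>) \<longlonglongrightarrow> 0"
proof -
  have [measurable]: "(\<lambda>\<omega>. (Z k \<omega>)\<^sup>2) \<in> borel_measurable M" for k using assms(1) by auto
  have c: "0 \<le> c k" for k using le[of k] by (rule order_trans[rotated]) simp
  have "(\<integral>\<^sup>+\<omega>. (\<Sum>k. ennreal ((Z k \<omega>)\<^sup>2)) \<partial>M) = (\<Sum>k. ennreal (expectation (\<lambda>\<omega>. (Z k \<omega>)\<^sup>2)))"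
    by (subst nn_integral_suminf) (auto simp: nn_integral_eq_integral assms(1))
  also have "\<dots> \<le> (\<Sum>k. ennreal (c k))" by (intro suminf_le ennreal_leI le) auto
  also have "\<dots> < \<infinity>" using \<open>summable c\<close> c by (simp add: suminf_ennreal2)
  finally have "(\<integral>\<^sup>+\<omega>. (\<Sum>k. ennreal ((Z k \<omega>)\<^sup>2)) \<partial>M) \<noteq> \<infinity>" by simp
  then have "AE \<omega> in M. (\<Sum>k. ennreal ((Z k \<omega>)\<^sup>2)) \<noteq> \<infinity>"
    by (intro nn_integral_PInf_AE) auto
  then show ?thesis
  proof (rule AE_mp, intro AE_I2 impI)
    fix \<omega> assume "(\<Sum>k. ennreal ((Z k \<omega>)\<^sup>2)) \<noteq> \<infinity>"
    then have "summable (\<lambda>k. (Z k \<omega>)\<^sup>2)" by (intro summable_suminf_not_top) auto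
    then have "(\<lambda>k. (Z k \<omega>)\<^sup>2) \<longlonglongrightarrow> 0" by (rule summable_LIMSEQ_zero)
    then have "(\<lambda>k. sqrt ((Z k \<omega>)\<^sup>2)) \<longlonglongrightarrow> sqrt 0" by (rule tendsto_real_sqrt)
    then show "(\<lambda>k. Z k \<omega>) \<longlonglongrightarrow> 0" by (simp add: tendsto_rabs_zero_iff)
  qed
qed

section \<open>Variance of crossing times\<close>

lemma integrable_square_add:
  fixes f g :: "'b \<Rightarrow> real"
  assumes [measurable]: "f \<in> borel_measurable M" "g \<in> borel_measurable M"
    and "integrable M (\<lambda>x. (f x)\<^sup>2)" "integrable M (\<lambda>x. (g x)\<^sup>2)"
  shows "integrable M (\<lambda>x. (f x + g x)\<^sup>2)"
proof (rule Bochner_Integration.integrable_bound)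
  show "integrable M (\<lambda>x. 2 * (f x)\<^sup>2 + 2 * (g x)\<^sup>2)" using assms by simp
  have "norm ((f x + g x)\<^sup>2) \<le> norm (2 * (f x)\<^sup>2 + 2 * (g x)\<^sup>2)" for x
    proof -
    have "(f x + g x)\<^sup>2 \<le> 2 * (f x)\<^sup>2 + 2 * (g x)\<^sup>2"
      using zero_le_power2[of "f x - g x"] by (simp add: power2_sum power2_diff)
    then show ?thesis by simp
  qed
  then show "AE x in M. norm ((f x + g x)\<^sup>2) \<le> norm (2 * (f x)\<^sup>2 + 2 * (g x)\<^sup>2)" by simp
qed simp

section \<open>Product model with whole columns as coordinates\<close>

locale edge_law = prob_space G for G :: "real measure" +
  assumes sets_G [simp, measurable_cong]: "sets G = sets borel"
begin

abbreviation column :: "(int \<Rightarrow> real) measure" where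
  "column \<equiv> PiM UNIV (\<lambda>_. G)"

abbreviation columns :: "nat \<Rightarrow> (nat \<Rightarrow> int \<Rightarrow> real) measure" where
  "columns n \<equiv> PiM {..<n} (\<lambda>_. column)"

lemma space_G [simp]: "space G = UNIV"
  using sets_eq_imp_space_eq[OF sets_G] by simp

lemma prob_space_column: "prob_space column"
  by (rule prob_space_PiM) (rule prob_space_axioms)

lemma prob_space_columns: "prob_space (columns n)"
  by (rule prob_space_PiM) (rule prob_space_column)

lemma space_column [simp]: "space column = UNIV"
  by (simp add: space_PiM)

lemma column_component [measurable]: "(\<lambda>c. c y) \<in> borel_measurable column"
  using measurable_component_singleton[of y UNIV "\<lambda>_. G"] by simp

lemma columns_component:
  assumes "i < n" shows "(\<lambda>x. x i y) \<in> borel_measurable (columns n)"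
proof -
  have "(\<lambda>x. x i) \<in> measurable (columns n) column" using assms by simp
  then show ?thesis by (rule measurable_compose) (rule column_component)
qed

lemma product_prob_space_edges: "product_prob_space (\<lambda>_. G)"
  by (simp add: product_prob_space_def product_prob_space_axioms_def product_sigma_finite_def
      prob_space_axioms sigma_finite_measure_axioms)

lemma product_prob_space_columns: "product_prob_space (\<lambda>_. column)"
  by (simp add: product_prob_space_def product_prob_space_axioms_def product_sigma_finite_def
      prob_space_column prob_space_imp_sigma_finite)

text \<open>The sets |x| <= n exhaust the line, so one of them has positive mass. Edges within such
  a bound serve as the cheap ones.\<close>

lemma exists_positive_interval: "\<exists>a\<ge>0. 0 < prob {x. \<bar>x\<bar> \<le> a}"
proof (rule ccontr)
  assume "\<not> ?thesis"
  then have "prob {x. \<bar>x\<bar> \<le> real n} = 0" for n :: nat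
    using measure_nonneg[of G "{x. \<bar>x\<bar> \<le> real n}"] by (metis of_nat_0_le_iff order_le_less)
  then have "emeasure G {x. \<bar>x\<bar> \<le> real n} = 0" for n :: nat
    by (simp add: emeasure_eq_measure)
  then have "emeasure G (\<Union>n::nat. {x. \<bar>x\<bar> \<le> real n}) = 0"
    by (intro emeasure_UN_eq_0) auto
  moreover have "(\<Union>n::nat. {x. \<bar>x\<bar> \<le> real n}) = (UNIV :: real set)"
    by (auto intro: real_arch_simple)
  ultimately show False using emeasure_space_1 by simp
qed

text \<open>Going up from \<open>z\<close> until the first edge of weight at most \<open>a\<close> costs a geometric number of
  steps, which gives the second moment without any assumption on the tail of \<open>G\<close>.\<close>

lemma detour_cost_second_moment:
  "\<exists>K\<ge>0. \<forall>z. (\<integral>\<^sup>+c. ennreal ((detour_cost c z + 1)\<^sup>2) \<partial>column) \<le> ennreal K"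
proof -
  interpret Z: product_prob_space "\<lambda>_. G" "UNIV :: int set"
    by (rule product_prob_space_edges)
  obtain a where a: "a \<ge> 0" "0 < prob {x. \<bar>x\<bar> \<le> a}" using exists_positive_interval by blast
  define q where "q = prob {x. a < \<bar>x\<bar>}"
  have "q = prob (space G - {x. \<bar>x\<bar> \<le> a})" unfolding q_def by (rule arg_cong[of _ _ prob]) auto
  also have "\<dots> = 1 - prob {x. \<bar>x\<bar> \<le> a}" by (rule prob_compl) simp
  finally have q: "0 \<le> q" "q < 1" using a by (auto simp: q_def)
  \<comment> \<open>If the first cheap edge is \<open>N\<close> steps above \<open>z\<close>, then
    (a + 1 + 2 N)^2 <= 2 (a + 1)^2 + 8 N^2 and 8 N^2 <= 16 (1 + ... + N). The sum of (k + 1) q^k is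
    1 / (1 - q)^2.\<close>
  define K where "K = 2 * (a + 1)\<^sup>2 + 16 / (1 - q)\<^sup>2"
  have "(\<integral>\<^sup>+c. ennreal ((detour_cost c z + 1)\<^sup>2) \<partial>column) \<le> ennreal K" for z
  proof -
    \<comment> \<open>The first k + 1 edges upward from \<open>z\<close> are all expensive; this
      happens whenever k < N.\<close>
    define A where "A k = {c \<in> space column. \<forall>y\<in>{z..z + int k}. c y \<in> {x. a < \<bar>x\<bar>}}" for k :: nat
    have A_meas [measurable]: "A k \<in> sets column" for k
      unfolding A_def by measurable
    have A_prob: "emeasure column (A k) = ennreal (q ^ Suc k)" for k
    proof -
      have "emeasure column (A k) = (\<Prod>y\<in>{z..z + int k}. emeasure G {x. a < \<bar>x\<bar>})"
        unfolding A_def by (rule Z.emeasure_PiM_Collect) auto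
      also have "\<dots> = ennreal (q ^ Suc k)"
        unfolding prod_constant q_def emeasure_eq_measure
        by (subst ennreal_power) (simp_all add: nat_add_distrib)
      finally show ?thesis .
    qed
    have bound: "ennreal ((detour_cost c z + 1)\<^sup>2)
        \<le> ennreal (2 * (a + 1)\<^sup>2) + (\<Sum>k. ennreal (16 * real (Suc k)) * indicator (A k) c)" for c
    proof (cases "\<exists>N. \<bar>c (z + int N)\<bar> \<le> a")
      case True
      define N where "N = (LEAST N. \<bar>c (z + int N)\<bar> \<le> a)"
      have N: "\<bar>c (z + int N)\<bar> \<le> a" using True unfolding N_def by (rule LeastI_ex)
      have less: "a < \<bar>c (z + int k)\<bar>" if "k < N" for k
        using not_less_Least[of k "\<lambda>N. \<bar>c (z + int N)\<bar> \<le> a"] that by (simp add: N_def)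
      have inA: "c \<in> A k" if "k < N" for k
      proof -
        have "a < \<bar>c y\<bar>" if "y \<in> {z..z + int k}" for y
          using less[of "nat (y - z)"] that \<open>k < N\<close> by auto
        then show ?thesis by (simp add: A_def)
      qed
      have "detour_cost c z + 1 \<le> (a + 1) + 2 * real N"
        using detour_cost_le[of c z "z + int N"] N by simp
      then have "(detour_cost c z + 1)\<^sup>2 \<le> ((a + 1) + 2 * real N)\<^sup>2"
        using detour_cost_nonneg[of c z] by (intro power_mono) auto
      also have "\<dots> \<le> 2 * (a + 1)\<^sup>2 + 8 * (real N)\<^sup>2"
        using zero_le_power2[of "(a + 1) - 2 * real N"] by (simp add: power2_eq_square algebra_simps)
      also have "8 * (real N)\<^sup>2 \<le> (\<Sum>k<N. 16 * real (Suc k))"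
        by (induction N) (auto simp: power2_eq_square algebra_simps)
      finally have "ennreal ((detour_cost c z + 1)\<^sup>2)
          \<le> ennreal (2 * (a + 1)\<^sup>2) + ennreal (\<Sum>k<N. 16 * real (Suc k))"
        by (subst ennreal_plus[symmetric]) (auto intro!: ennreal_leI sum_nonneg)
      also have "ennreal (\<Sum>k<N. 16 * real (Suc k)) = (\<Sum>k<N. ennreal (16 * real (Suc k)))"
        by (subst sum_ennreal) auto
      also have "\<dots> = (\<Sum>k<N. ennreal (16 * real (Suc k)) * indicator (A k) c)"
        using inA by (intro sum.cong) auto
      also have "\<dots> \<le> (\<Sum>k. ennreal (16 * real (Suc k)) * indicator (A k) c)"
        by (rule sum_le_suminf) auto
      finally show ?thesis by (simp add: add_left_mono)
    next
      \<comment> \<open>No cheap edge at or above \<open>z\<close>: all events occur, the right-hand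
        side is infinite and the bound is trivial.\<close>
      case False
      then have less: "a < \<bar>c (z + int k)\<bar>" for k by (metis not_le)
      have "c \<in> A k" for k
      proof -
        have "a < \<bar>c y\<bar>" if "y \<in> {z..z + int k}" for y
          using less[of "nat (y - z)"] that by auto
        then show ?thesis by (simp add: A_def)
      qed
      then have "(\<Sum>k. ennreal (16 * real (Suc k)) * indicator (A k) c) = (\<Sum>k. ennreal (16 * real (Suc k)))"
        by simp
      also have "\<dots> = \<top>"
      proof (rule ccontr)
        assume "(\<Sum>k. ennreal (16 * real (Suc k))) \<noteq> \<top>"
        then have "summable (\<lambda>k. 16 * real (Suc k))" by (intro summable_suminf_not_top) auto
        then have "(\<lambda>k. 16 * real (Suc k)) \<longlonglongrightarrow> 0" by (rule summable_LIMSEQ_zero)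
        moreover have "\<forall>k. 1 \<le> 16 * real (Suc k)" by auto
        ultimately show False by (metis LIMSEQ_le_const not_one_le_zero)
      qed
      finally show ?thesis by simp
    qed
    have "(\<integral>\<^sup>+c. ennreal ((detour_cost c z + 1)\<^sup>2) \<partial>column)
        \<le> (\<integral>\<^sup>+c. ennreal (2 * (a + 1)\<^sup>2) + (\<Sum>k. ennreal (16 * real (Suc k)) * indicator (A k) c) \<partial>column)"
      by (intro nn_integral_mono bound)
    also have "\<dots> = ennreal (2 * (a + 1)\<^sup>2) + (\<integral>\<^sup>+c. (\<Sum>k. ennreal (16 * real (Suc k)) * indicator (A k) c) \<partial>column)"
      using prob_space.emeasure_space_1[OF prob_space_column]
      by (subst nn_integral_add) auto
    also have "(\<integral>\<^sup>+c. (\<Sum>k. ennreal (16 * real (Suc k)) * indicator (A k) c) \<partial>column)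
        = (\<Sum>k. ennreal (16 * real (Suc k)) * ennreal (q ^ Suc k))"
      by (subst nn_integral_suminf) (auto simp: nn_integral_cmult_indicator A_prob)
    \<comment> \<open>Weakened from q^(k + 1) to q^k to match the derivative of the geometric
      series.\<close>
    also have "\<dots> \<le> (\<Sum>k. ennreal (16 * (real (Suc k) * q ^ k)))"
    proof (intro suminf_le)
      fix k
      have "q ^ Suc k \<le> q ^ k" using q by (intro power_decreasing) auto
      then show "ennreal (16 * real (Suc k)) * ennreal (q ^ Suc k) \<le> ennreal (16 * (real (Suc k) * q ^ k))"
        using q by (subst ennreal_mult[symmetric])
          (auto intro!: ennreal_leI mult_left_mono simp: mult.assoc simp del: power_Suc of_nat_Suc)
    qed auto
    also have "\<dots> = ennreal (16 / (1 - q)\<^sup>2)"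
    proof -
      have "(\<lambda>k. 16 * (real (Suc k) * q ^ k)) sums (16 * (1 / (1 - q)\<^sup>2))"
        using geometric_deriv_sums[of q] q by (intro sums_mult) auto
      then show ?thesis using q by (subst suminf_ennreal_eq) auto
    qed
    finally show ?thesis using q unfolding K_def by (subst ennreal_plus) (auto simp: add_left_mono)
  qed
  moreover have "0 \<le> K" by (simp add: K_def)
  ultimately show ?thesis by blast
qed

text \<open>Fixed once, uniformly in \<open>z\<close>. The added 1 is the slack with which
  \<open>crossing_time_column_le_detour_cost\<close> is applied.\<close>

definition second_moment_bound :: real where
  "second_moment_bound = (SOME K. 0 \<le> K \<and>
     (\<forall>z. (\<integral>\<^sup>+c. ennreal ((detour_cost c z + 1)\<^sup>2) \<partial>column) \<le> ennreal K))"

lemma second_moment_bound_nonneg: "0 \<le> second_moment_bound"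
  and nn_integral_detour_cost:
    "(\<integral>\<^sup>+c. ennreal ((detour_cost c z + 1)\<^sup>2) \<partial>column) \<le> ennreal second_moment_bound"
  using someI_ex[of "\<lambda>K. 0 \<le> K \<and> (\<forall>z. (\<integral>\<^sup>+c. ennreal ((detour_cost c z + 1)\<^sup>2) \<partial>column) \<le> ennreal K)"]
    detour_cost_second_moment unfolding second_moment_bound_def by blast+

lemma integrable_detour_cost: "integrable column (\<lambda>c. (detour_cost c z + 1)\<^sup>2)"
  by (rule integrableI_nonneg)
    (auto intro: le_less_trans[OF nn_integral_detour_cost])

lemma integral_detour_cost: "(\<integral>c. (detour_cost c z + 1)\<^sup>2 \<partial>column) \<le> second_moment_bound"
  using nn_integral_detour_cost[of z] second_moment_bound_nonneg
  by (subst (asm) nn_integral_eq_integral[OF integrable_detour_cost]) auto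

lemma crossing_time_columns_measurable [measurable]:
  "k \<le> n \<Longrightarrow> (\<lambda>x. crossing_time x k m) \<in> borel_measurable (columns n)"
  by (intro crossing_time_measurable columns_component) auto

text \<open>One column at a time: each adds at most its detour cost at height \<open>m\<close>,
  which is square integrable.\<close>

lemma integrable_square_crossing_time:
  "k \<le> n \<Longrightarrow> integrable (columns n) (\<lambda>x. (crossing_time x k m)\<^sup>2)"
proof (induction k)
  case 0
  interpret Q: prob_space "columns n" by (rule prob_space_columns)
  show ?case by simp
next
  case (Suc k)
  interpret Z: product_prob_space "\<lambda>_. column" "{..<n}"
    by (rule product_prob_space_columns)
  have k: "k < n" "k \<le> n" using Suc.prems by auto
  note [measurable] = columns_component[OF k(1)]
  have comp [measurable]: "(\<lambda>x. x k) \<in> measurable (columns n) column" using k by simp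
  have "integrable (distr (columns n) column (\<lambda>x. x k)) (\<lambda>c. (detour_cost c m + 1)\<^sup>2)"
    using Z.PiM_component[of k] k integrable_detour_cost by simp
  then have "integrable (columns n) (\<lambda>x. (detour_cost (x k) m + 1)\<^sup>2)"
    by (subst (asm) integrable_distr_eq) auto
  then have "integrable (columns n) (\<lambda>x. (crossing_time x k m + (detour_cost (x k) m + 1))\<^sup>2)"
    using Suc.IH[OF k(2)] crossing_time_columns_measurable[OF k(2)]
    by (intro integrable_square_add[of _ _ "\<lambda>x. detour_cost (x k) m + 1"]) auto
  then show ?case
  proof (rule Bochner_Integration.integrable_bound)
    have "\<bar>crossing_time x (Suc k) m\<bar> \<le> \<bar>crossing_time x k m + (detour_cost (x k) m + 1)\<bar>" for x
      using crossing_time_Suc_le_detour_cost[of x k m] crossing_time_nonneg[of x "Suc k" m] by linarith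
    then show "AE x in columns n. norm ((crossing_time x (Suc k) m)\<^sup>2)
        \<le> norm ((crossing_time x k m + (detour_cost (x k) m + 1))\<^sup>2)"
      by (simp add: abs_le_square_iff[symmetric])
    show "(\<lambda>x. (crossing_time x (Suc k) m)\<^sup>2) \<in> borel_measurable (columns n)"
      using crossing_time_columns_measurable[OF Suc.prems] by simp
  qed
qed

lemma integrable_crossing_time: "integrable (columns n) (\<lambda>x. crossing_time x n m)"
proof -
  interpret Q: prob_space "columns n" by (rule prob_space_columns)
  show ?thesis
    by (rule Q.square_integrable_imp_integrable)
       (auto intro: integrable_square_crossing_time)
qed

text \<open>With the other columns frozen the height \<open>z\<close> is a constant, so integrating
  over column \<open>i\<close> alone leaves the second moment of a detour cost at a fixed height.
  That bound is uniform in \<open>z\<close>, which may thus depend on the other columns in any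
  way.\<close>

lemma column_influence:
  assumes i: "i < n" and R: "0 \<le> R"
  shows "(\<integral>x. (min (crossing_time x n m) R - min (crossing_time (x(i := (\<lambda>_. 0))) n m) R)\<^sup>2 \<partial>columns n)
           \<le> second_moment_bound"
    (is "integral\<^sup>L _ ?h \<le> _")
proof -
  interpret Z: product_prob_space "\<lambda>_. column" "{..<n}"
    by (rule product_prob_space_columns)
  interpret Q: prob_space "PiM ({..<n} - {i}) (\<lambda>_. column)"
    by (rule prob_space_PiM) (rule prob_space_column)
  interpret C: prob_space column by (rule prob_space_column)
  have [measurable]: "(\<lambda>x. crossing_time (x(i := (\<lambda>_. 0))) n m) \<in> borel_measurable (columns n)"
  proof (rule crossing_time_measurable)
    fix j y assume "j < n"
    then show "(\<lambda>x. (x(i := (\<lambda>_. 0))) j y) \<in> borel_measurable (columns n)"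
      using columns_component[of j n y] by (cases "j = i") auto
  qed
  have bound: "\<bar>?h x\<bar> \<le> R\<^sup>2" for x
  proof -
    have "\<bar>min (crossing_time x n m) R - min (crossing_time (x(i := (\<lambda>_. 0))) n m) R\<bar> \<le> \<bar>R\<bar>"
      using crossing_time_nonneg[of x n m] crossing_time_nonneg[of "x(i := (\<lambda>_. 0))" n m] R by linarith
    then show ?thesis by (simp add: abs_le_square_iff[symmetric])
  qed
  have int: "integrable (columns n) ?h"
    using bound by (intro Z.P.integrable_const_bound[of _ "R\<^sup>2"]) auto
  have ins: "insert i ({..<n} - {i}) = {..<n}" using i by auto
  have "integral\<^sup>L (columns n) ?h = (\<integral>x. (\<integral>c. ?h (x(i := c)) \<partial>column) \<partial>PiM ({..<n} - {i}) (\<lambda>_. column))"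
    using Z.product_integral_insert[of "{..<n} - {i}" i ?h] int unfolding ins by simp
  also have "\<dots> \<le> (\<integral>x. second_moment_bound \<partial>PiM ({..<n} - {i}) (\<lambda>_. column))"
  proof (rule integral_mono')
    fix x :: "nat \<Rightarrow> int \<Rightarrow> real"
    obtain z where z: "\<And>c. crossing_time (x(i := c)) n m
        \<le> crossing_time (x(i := (\<lambda>_. 0))) n m + detour_cost c z + 1"
      using crossing_time_column_le_detour_cost[of 1 x i n m] zero_less_one by blast
    have "(\<integral>c. ?h (x(i := c)) \<partial>column) \<le> (\<integral>c. (detour_cost c z + 1)\<^sup>2 \<partial>column)"
    proof (rule integral_mono'[OF integrable_detour_cost])
      fix c
      \<comment> \<open>Truncation at \<open>R\<close> does not increase distances, and zeroing a
        column only lowers the time, so one upper bound controls the difference.\<close>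
      have "\<bar>min (crossing_time (x(i := c)) n m) R - min (crossing_time (x(i := (\<lambda>_. 0))) n m) R\<bar>
          \<le> \<bar>detour_cost c z + 1\<bar>"
        using z[of c] crossing_time_zero_column_le[of "x(i := c)" i n m] detour_cost_nonneg[of c z]
        unfolding fun_upd_upd by linarith
      then show "?h (x(i := c)) \<le> (detour_cost c z + 1)\<^sup>2"
        unfolding fun_upd_upd by (simp add: abs_le_square_iff[symmetric])
    qed auto
    also note integral_detour_cost
    finally show "(\<integral>c. ?h (x(i := c)) \<partial>column) \<le> second_moment_bound" .
  qed (auto simp: second_moment_bound_nonneg)
  also have "\<dots> = second_moment_bound" by (simp add: Q.prob_space)
  finally show ?thesis .
qed

text \<open>Truncation supplies the boundedness that \<open>efron_stein\<close> asks for, while the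
  resulting bound does not involve \<open>R\<close>.\<close>

lemma truncated_variance:
  assumes R: "0 \<le> R"
  shows "(\<integral>x. (min (crossing_time x n m) R)\<^sup>2 \<partial>columns n) - (\<integral>x. min (crossing_time x n m) R \<partial>columns n)\<^sup>2
           \<le> real n * second_moment_bound"
proof -
  let ?g = "\<lambda>i x. min (crossing_time (x(i := (\<lambda>_. 0))) n m) R"
  have "(\<integral>x. (min (crossing_time x n m) R)\<^sup>2 \<partial>columns n) - (\<integral>x. min (crossing_time x n m) R \<partial>columns n)\<^sup>2
      \<le> (\<Sum>i<n. \<integral>x. (min (crossing_time x n m) R - ?g i x)\<^sup>2 \<partial>columns n)"
  proof (rule efron_stein[where B = R])
    show "(\<lambda>x. min (crossing_time x n m) R) \<in> borel_measurable (columns n)" by simp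
    show "\<bar>min (crossing_time x n m) R\<bar> \<le> R" for x using crossing_time_nonneg[of x n m] R by simp
    fix i
    show "\<bar>?g i x\<bar> \<le> R" for x using crossing_time_nonneg[of "x(i := (\<lambda>_. 0))" n m] R by simp
    have [measurable]: "(\<lambda>x. crossing_time (x(i := (\<lambda>_. 0))) n m) \<in> borel_measurable (columns n)"
    proof (rule crossing_time_measurable)
      fix j y assume "j < n"
      then show "(\<lambda>x. (x(i := (\<lambda>_. 0))) j y) \<in> borel_measurable (columns n)"
        using columns_component[of j n y] by (cases "j = i") auto
    qed
    show "?g i \<in> borel_measurable (columns n)" by simp
  qed (simp_all add: prob_space_column)
  also have "\<dots> \<le> (\<Sum>i<n. second_moment_bound)"
    using column_influence R by (intro sum_mono) auto
  finally show ?thesis by simp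
qed

definition mean_crossing_time :: "nat \<Rightarrow> int \<Rightarrow> real" where
  "mean_crossing_time n m = (\<integral>x. crossing_time x n m \<partial>columns n)"

text \<open>Let the truncation level tend to infinity; the crossing time and its square dominate the
  two moments.\<close>

lemma variance_crossing_time:
  "(\<integral>x. (crossing_time x n m - mean_crossing_time n m)\<^sup>2 \<partial>columns n) \<le> real n * second_moment_bound"
proof -
  interpret Q: prob_space "columns n" by (rule prob_space_columns)
  have lim: "(\<lambda>k. min (crossing_time x n m) (real k)) \<longlonglongrightarrow> crossing_time x n m" for x
  proof (rule tendsto_eventually)
    obtain k0 where "crossing_time x n m \<le> real k0" using real_arch_simple by blast
    then show "\<forall>\<^sub>F k in sequentially. min (crossing_time x n m) (real k) = crossing_time x n m"
      unfolding eventually_sequentially by (intro exI[of _ k0]) auto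
  qed
  have "(\<lambda>k. \<integral>x. min (crossing_time x n m) (real k) \<partial>columns n) \<longlonglongrightarrow> (\<integral>x. crossing_time x n m \<partial>columns n)"
    by (rule integral_dominated_convergence[where w = "\<lambda>x. crossing_time x n m"])
      (auto intro!: lim integrable_crossing_time simp: crossing_time_nonneg)
  moreover have "(\<lambda>k. \<integral>x. (min (crossing_time x n m) (real k))\<^sup>2 \<partial>columns n) \<longlonglongrightarrow> (\<integral>x. (crossing_time x n m)\<^sup>2 \<partial>columns n)"
    by (rule integral_dominated_convergence[where w = "\<lambda>x. (crossing_time x n m)\<^sup>2"])
      (auto intro!: lim tendsto_power integrable_square_crossing_time power_mono simp: crossing_time_nonneg)
  ultimately have "(\<lambda>k. (\<integral>x. (min (crossing_time x n m) (real k))\<^sup>2 \<partial>columns n)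
        - (\<integral>x. min (crossing_time x n m) (real k) \<partial>columns n)\<^sup>2)
      \<longlonglongrightarrow> (\<integral>x. (crossing_time x n m)\<^sup>2 \<partial>columns n) - (\<integral>x. crossing_time x n m \<partial>columns n)\<^sup>2"
    by (intro tendsto_diff tendsto_power)
  then have "(\<integral>x. (crossing_time x n m)\<^sup>2 \<partial>columns n) - (\<integral>x. crossing_time x n m \<partial>columns n)\<^sup>2
      \<le> real n * second_moment_bound"
    by (rule LIMSEQ_le_const2) (intro exI allI impI truncated_variance of_nat_0_le_iff)
  then show ?thesis
    unfolding mean_crossing_time_def
    by (subst Q.variance_eq) (auto intro: integrable_crossing_time integrable_square_crossing_time)
qed

end

section \<open>From the product model to arbitrary independent weights\<close>

lemma (in prob_space) indep_vars_reindex_inj: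
  assumes "indep_vars (\<lambda>_. N) X UNIV" "inj_on f J"
  shows "indep_vars (\<lambda>_. N) (\<lambda>i. X (f i)) J"
proof -
  \<comment> \<open>Group the variables into singleton blocks, disjoint by injectivity, and then
    read off the only entry of each block.\<close>
  have "indep_vars (\<lambda>j. PiM {f j} (\<lambda>_. N)) (\<lambda>j \<omega>. restrict (\<lambda>i. X i \<omega>) {f j}) J"
    using assms by (intro indep_vars_restrict) (auto simp: disjoint_family_on_def inj_on_def)
  then have "indep_vars (\<lambda>_. N) (\<lambda>j \<omega>. (restrict (\<lambda>i. X i \<omega>) {f j}) (f j)) J"
    by (rule indep_vars_compose2) simp
  then show ?thesis by simp
qed

text \<open>Serves the case of no columns, where both laws are point masses.\<close>

lemma (in prob_space) distr_empty_PiM: "distr M (PiM {} N) (\<lambda>\<omega>. \<lambda>i\<in>{}. X i \<omega>) = PiM {} N"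
proof (rule measure_eqI)
  fix A assume "A \<in> sets (distr M (PiM {} N) (\<lambda>\<omega>. \<lambda>i\<in>{}. X i \<omega>))"
  then have "A \<subseteq> {\<lambda>_. undefined}" using sets.sets_into_space[of A "PiM {} N"] by (auto simp: space_PiM)
  then have "A = {} \<or> A = {\<lambda>_. undefined}" by blast
  moreover have "emeasure (distr M (PiM {} N) (\<lambda>\<omega>. \<lambda>i\<in>{}. X i \<omega>)) {\<lambda>_. undefined} = 1"
  proof -
    have "(\<lambda>\<omega>. \<lambda>i\<in>{}. X i \<omega>) = (\<lambda>\<omega> i. undefined)" by (simp add: restrict_def)
    then show ?thesis by (simp add: emeasure_distr emeasure_space_1 PiM_empty)
  qed
  ultimately show "emeasure (distr M (PiM {} N) (\<lambda>\<omega>. \<lambda>i\<in>{}. X i \<omega>)) A = emeasure (PiM {} N) A"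
    by (auto simp: PiM_empty)
qed simp

context edge_law
begin

definition iid_weights :: "'b measure \<Rightarrow> (pt \<Rightarrow> 'b \<Rightarrow> real) \<Rightarrow> bool" where
  "iid_weights M \<tau> \<longleftrightarrow> prob_space M \<and> prob_space.indep_vars M (\<lambda>_. borel) \<tau> UNIV
     \<and> (\<forall>z. distr M borel (\<tau> z) = G)"

lemma iid_weights_measurable: "iid_weights M \<tau> \<Longrightarrow> \<tau> z \<in> borel_measurable M"
  unfolding iid_weights_def by (cases z) (auto simp: prob_space.indep_vars_def)

abbreviation shifted :: "(pt \<Rightarrow> 'b \<Rightarrow> real) \<Rightarrow> int \<Rightarrow> int \<Rightarrow> 'b \<Rightarrow> nat \<Rightarrow> int \<Rightarrow> real" where
  "shifted \<tau> a b \<omega> \<equiv> \<lambda>i y. \<tau> (a + int i, b + y) \<omega>"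

text \<open>Carries every moment computed in the product model over to given weights, seen from any
  origin (a, b).\<close>

lemma columns_law:
  assumes "iid_weights M \<tau>"
  shows "distr M (columns n) (\<lambda>\<omega>. \<lambda>i\<in>{..<n}. shifted \<tau> a b \<omega> i) = columns n"
proof (cases "n = 0")
  case True
  then show ?thesis
    using prob_space.distr_empty_PiM[of M "\<lambda>_. column" "\<lambda>i \<omega>. shifted \<tau> a b \<omega> i"] assms
    by (simp add: iid_weights_def)
next
  case False
  interpret M: prob_space M using assms by (simp add: iid_weights_def)
  have ind: "M.indep_vars (\<lambda>_. borel) \<tau> UNIV" and law: "\<And>z. distr M borel (\<tau> z) = G"
    using assms by (auto simp: iid_weights_def)
  note [measurable] = iid_weights_measurable[OF assms]
  let ?B = "PiM UNIV (\<lambda>_. borel) :: (int \<Rightarrow> real) measure"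
  let ?X = "\<lambda>i \<omega>. shifted \<tau> a b \<omega> i"
  have sets_B: "sets column = sets ?B" by (intro sets_PiM_cong) auto
  have X_meas: "?X i \<in> measurable M ?B" for i
    using measurable_restrict[of UNIV "\<lambda>y. \<tau> (a + int i, b + y)" M "\<lambda>_. borel"]
      iid_weights_measurable[OF assms] by (simp only: restrict_UNIV)
  have col: "distr M ?B (?X i) = column" for i
  proof -
    have "M.indep_vars (\<lambda>_. borel) (\<lambda>y. \<tau> (a + int i, b + y)) UNIV"
      by (rule M.indep_vars_reindex_inj[OF ind]) (auto simp: inj_on_def)
    then show ?thesis
      by (subst (asm) M.indep_vars_iff_distr_eq_PiM') (auto simp: law restrict_UNIV)
  qed
  \<comment> \<open>Distinct columns use disjoint sets of edges, hence form independent
    blocks.\<close>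
  have "M.indep_vars (\<lambda>i. PiM ({a + int i} \<times> UNIV) (\<lambda>_. borel))
      (\<lambda>i \<omega>. restrict (\<lambda>z. \<tau> z \<omega>) ({a + int i} \<times> UNIV)) {..<n}"
    using ind by (intro M.indep_vars_restrict) (auto simp: disjoint_family_on_def)
  then have "M.indep_vars (\<lambda>_. ?B)
      (\<lambda>i \<omega>. (\<lambda>c. \<lambda>y\<in>UNIV. c (a + int i, b + y)) (restrict (\<lambda>z. \<tau> z \<omega>) ({a + int i} \<times> UNIV))) {..<n}"
    by (rule M.indep_vars_compose2) (intro measurable_restrict measurable_component_singleton, auto)
  then have "M.indep_vars (\<lambda>_. ?B) ?X {..<n}" by (simp add: restrict_UNIV)
  then have "distr M (PiM {..<n} (\<lambda>_. ?B)) (\<lambda>\<omega>. \<lambda>i\<in>{..<n}. ?X i \<omega>) = columns n"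
    using False X_meas by (subst (asm) M.indep_vars_iff_distr_eq_PiM') (auto simp: col lessThan_empty_iff)
  moreover have "distr M (columns n) (\<lambda>\<omega>. \<lambda>i\<in>{..<n}. ?X i \<omega>)
      = distr M (PiM {..<n} (\<lambda>_. ?B)) (\<lambda>\<omega>. \<lambda>i\<in>{..<n}. ?X i \<omega>)"
    by (intro distr_cong sets_PiM_cong sets_B) auto
  ultimately show ?thesis by simp
qed

lemma shifted_measurable:
  assumes "iid_weights M \<tau>"
  shows "(\<lambda>\<omega>. \<lambda>i\<in>{..<n}. shifted \<tau> a b \<omega> i) \<in> measurable M (columns n)"
proof (rule measurable_restrict)
  note [measurable] = iid_weights_measurable[OF assms]
  have "(\<lambda>\<omega>. \<lambda>y\<in>UNIV. \<tau> (a + int i, b + y) \<omega>) \<in> measurable M column" for i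
    by (rule measurable_restrict) simp
  then show "(\<lambda>\<omega>. shifted \<tau> a b \<omega> i) \<in> measurable M column" for i by (simp only: restrict_UNIV)
qed

text \<open>A crossing of \<open>n\<close> columns reads only the first \<open>n\<close> of them, so
  all four facts are pulled back along \<open>columns_law\<close>.\<close>

lemma
  assumes iid: "iid_weights M \<tau>"
  shows integrable_crossing_time_shifted:
      "integrable M (\<lambda>\<omega>. crossing_time (shifted \<tau> a b \<omega>) n m)"
    and integral_crossing_time_shifted:
      "(\<integral>\<omega>. crossing_time (shifted \<tau> a b \<omega>) n m \<partial>M) = mean_crossing_time n m"
    and integrable_crossing_time_deviation:
      "integrable M (\<lambda>\<omega>. (crossing_time (shifted \<tau> a b \<omega>) n m - mean_crossing_time n m)\<^sup>2)"
    and integral_crossing_time_deviation: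
      "(\<integral>\<omega>. (crossing_time (shifted \<tau> a b \<omega>) n m - mean_crossing_time n m)\<^sup>2 \<partial>M)
         \<le> real n * second_moment_bound"
proof -
  let ?X = "\<lambda>\<omega>. \<lambda>i\<in>{..<n}. shifted \<tau> a b \<omega> i"
  have eq: "crossing_time (?X \<omega>) n m = crossing_time (shifted \<tau> a b \<omega>) n m" for \<omega>
    by (rule crossing_time_cong) simp
  note X [measurable] = shifted_measurable[OF iid, of a b n]
  interpret Q: prob_space "columns n" by (rule prob_space_columns)
  have dev: "integrable (columns n) (\<lambda>x. (crossing_time x n m - mean_crossing_time n m)\<^sup>2)"
    unfolding diff_conv_add_uminus
    by (intro integrable_square_add integrable_square_crossing_time) auto
  have "integrable (distr M (columns n) ?X) (\<lambda>x. crossing_time x n m)"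
    unfolding columns_law[OF iid] by (rule integrable_crossing_time)
  then show "integrable M (\<lambda>\<omega>. crossing_time (shifted \<tau> a b \<omega>) n m)"
    by (subst (asm) integrable_distr_eq) (auto simp: eq)
  have "(\<integral>x. crossing_time x n m \<partial>distr M (columns n) ?X) = mean_crossing_time n m"
    unfolding columns_law[OF iid] mean_crossing_time_def ..
  then show "(\<integral>\<omega>. crossing_time (shifted \<tau> a b \<omega>) n m \<partial>M) = mean_crossing_time n m"
    by (subst (asm) integral_distr) (auto simp: eq)
  have "integrable (distr M (columns n) ?X) (\<lambda>x. (crossing_time x n m - mean_crossing_time n m)\<^sup>2)"
    unfolding columns_law[OF iid] by (rule dev)
  then show "integrable M (\<lambda>\<omega>. (crossing_time (shifted \<tau> a b \<omega>) n m - mean_crossing_time n m)\<^sup>2)"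
    by (subst (asm) integrable_distr_eq) (auto simp: eq)
  have "(\<integral>x. (crossing_time x n m - mean_crossing_time n m)\<^sup>2 \<partial>distr M (columns n) ?X)
      \<le> real n * second_moment_bound"
    unfolding columns_law[OF iid] by (rule variance_crossing_time)
  then show "(\<integral>\<omega>. (crossing_time (shifted \<tau> a b \<omega>) n m - mean_crossing_time n m)\<^sup>2 \<partial>M)
         \<le> real n * second_moment_bound"
    by (subst (asm) integral_distr) (auto simp: eq)
qed

text \<open>Subadditivity of the mean compares crossings of different stretches of columns, so it
  needs one space that carries all edges; the coordinate maps provide it.\<close>

lemma exists_iid_weights: "iid_weights (PiM UNIV (\<lambda>_. G)) (\<lambda>z \<omega>. \<omega> z)"
proof -
  let ?P = "PiM UNIV (\<lambda>_. G) :: (pt \<Rightarrow> real) measure"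
  interpret P: prob_space ?P by (rule prob_space_PiM) (rule prob_space_axioms)
  have law: "distr ?P borel (\<lambda>\<omega>. \<omega> z) = G" for z
  proof -
    have "distr ?P borel (\<lambda>\<omega>. \<omega> z) = distr ?P G (\<lambda>\<omega>. \<omega> z)" by (intro distr_cong) auto
    also have "\<dots> = G" by (rule distr_PiM_component) (auto intro: prob_space_axioms)
    finally show ?thesis .
  qed
  have rv: "(\<lambda>\<omega>. \<omega> z) \<in> borel_measurable ?P" for z
    unfolding measurable_cong_sets[OF refl sets_G[symmetric]] by simp
  have "distr ?P (PiM UNIV (\<lambda>_. borel)) (\<lambda>\<omega>. \<lambda>z\<in>UNIV. \<omega> z) = distr ?P ?P (\<lambda>\<omega>. \<omega>)"
    by (intro distr_cong sets_PiM_cong) auto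
  then have "P.indep_vars (\<lambda>_. borel) (\<lambda>z \<omega>. \<omega> z) UNIV"
    by (subst P.indep_vars_iff_distr_eq_PiM') (auto simp: law rv)
  then show ?thesis by (simp add: iid_weights_def P.prob_space_axioms law)
qed

section \<open>Mean crossing times\<close>

lemma mean_crossing_time_nonneg: "0 \<le> mean_crossing_time n m"
  unfolding mean_crossing_time_def by (simp add: crossing_time_nonneg)

lemma mean_crossing_time_0 [simp]: "mean_crossing_time 0 m = real_of_int \<bar>m\<bar>"
  using prob_space.prob_space[OF prob_space_columns, of 0] by (simp add: mean_crossing_time_def)

lemma mean_crossing_time_lipschitz:
  "mean_crossing_time n m \<le> mean_crossing_time n m' + real_of_int \<bar>m - m'\<bar>"
proof -
  interpret Q: prob_space "columns n" by (rule prob_space_columns)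
  have "mean_crossing_time n m \<le> (\<integral>x. crossing_time x n m' + real_of_int \<bar>m - m'\<bar> \<partial>columns n)"
    unfolding mean_crossing_time_def
    by (intro integral_mono integrable_crossing_time Bochner_Integration.integrable_add
        crossing_time_lipschitz) simp
  also have "\<dots> = mean_crossing_time n m' + real_of_int \<bar>m - m'\<bar>"
    unfolding mean_crossing_time_def
    by (subst Bochner_Integration.integral_add) (auto simp: Q.prob_space intro: integrable_crossing_time)
  finally show ?thesis .
qed

text \<open>The second route starts at (n, m); translation changes its environment but not its
  law.\<close>

lemma mean_crossing_time_subadditive:
  "mean_crossing_time (n + k) (m + l) \<le> mean_crossing_time n m + mean_crossing_time k l"
proof -
  let ?P = "PiM UNIV (\<lambda>_. G) :: (pt \<Rightarrow> real) measure" and ?\<tau> = "\<lambda>z \<omega>. \<omega> z"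
  note iid = exists_iid_weights
  have "mean_crossing_time (n + k) (m + l) = (\<integral>\<omega>. crossing_time (shifted ?\<tau> 0 0 \<omega>) (n + k) (m + l) \<partial>?P)"
    by (rule integral_crossing_time_shifted[OF iid, symmetric])
  also have "\<dots> \<le> (\<integral>\<omega>. crossing_time (shifted ?\<tau> 0 0 \<omega>) n m + crossing_time (shifted ?\<tau> (int n) m \<omega>) k l \<partial>?P)"
  proof (intro integral_mono Bochner_Integration.integrable_add integrable_crossing_time_shifted[OF iid])
    fix \<omega> :: "pt \<Rightarrow> real"
    show "crossing_time (shifted ?\<tau> 0 0 \<omega>) (n + k) (m + l)
        \<le> crossing_time (shifted ?\<tau> 0 0 \<omega>) n m + crossing_time (shifted ?\<tau> (int n) m \<omega>) k l"
      using crossing_time_subadditive[of "shifted ?\<tau> 0 0 \<omega>" n k m l] by simp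
  qed
  also have "\<dots> = mean_crossing_time n m + mean_crossing_time k l"
    by (subst Bochner_Integration.integral_add)
      (auto simp only: integrable_crossing_time_shifted[OF iid] integral_crossing_time_shifted[OF iid])
  finally show ?thesis .
qed

end

section \<open>The time constant\<close>

context edge_law
begin

text \<open>Built from the laws \<open>columns n\<close> alone, so it depends on G and not on the
  space that carries the weights.\<close>

definition time_constant :: "real \<Rightarrow> real" where
  "time_constant v = lim (\<lambda>n. mean_crossing_time n \<lceil>v * real n\<rceil> / real n)"

lemma time_constant_tendsto:
  "(\<lambda>n. mean_crossing_time n \<lceil>v * real n\<rceil> / real n) \<longlonglongrightarrow> time_constant v"
proof -
  \<comment> \<open>The added 1 absorbs the rounding: the ceiling of a sum differs from the sum of
    the ceilings by at most 1.\<close>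
  let ?b = "\<lambda>n. mean_crossing_time n \<lceil>v * real n\<rceil> + 1"
  have "convergent (\<lambda>n. ?b n / real n)"
  proof (rule fekete_subadditive)
    fix m n
    let ?d = "\<lceil>v * real (m + n)\<rceil> - (\<lceil>v * real m\<rceil> + \<lceil>v * real n\<rceil>)"
    have "mean_crossing_time (m + n) \<lceil>v * real (m + n)\<rceil>
        \<le> mean_crossing_time (m + n) (\<lceil>v * real m\<rceil> + \<lceil>v * real n\<rceil>) + real_of_int \<bar>?d\<bar>"
      by (rule mean_crossing_time_lipschitz)
    also have "real_of_int \<bar>?d\<bar> \<le> 1"
    proof -
      have "v * real (m + n) = v * real m + v * real n" by (simp add: algebra_simps)
      then have "\<bar>?d\<bar> \<le> 1" by linarith
      then show ?thesis by linarith
    qed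
    finally show "?b (m + n) \<le> ?b m + ?b n"
      using mean_crossing_time_subadditive[of m n "\<lceil>v * real m\<rceil>" "\<lceil>v * real n\<rceil>"] by linarith
    show "0 \<le> ?b n" using mean_crossing_time_nonneg[of n "\<lceil>v * real n\<rceil>"] by linarith
  qed
  then obtain L where L: "(\<lambda>n. ?b n / real n) \<longlonglongrightarrow> L" by (auto simp: convergent_def)
  have "(\<lambda>n. ?b n / real n - 1 / real n) \<longlonglongrightarrow> L - 0" by (intro tendsto_diff L lim_1_over_n)
  then have "(\<lambda>n. mean_crossing_time n \<lceil>v * real n\<rceil> / real n) \<longlonglongrightarrow> L"
    by (simp add: add_divide_distrib)
  then show ?thesis unfolding time_constant_def by (simp add: limI)
qed

lemma time_constant_nonneg: "0 \<le> time_constant v"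
  by (rule LIMSEQ_le_const[OF time_constant_tendsto]) (auto simp: mean_crossing_time_nonneg)

lemma convex_time_constant: "convex_on {0..} time_constant"
proof (rule convex_onI)
  fix t x y :: real
  assume t: "0 < t" "t < 1" and xy: "x \<in> {0..}" "y \<in> {0..}"
  define w where "w = (1 - t) * x + t * y"
  \<comment> \<open>The comparison route follows slope \<open>x\<close> through the first
    \<open>j n\<close> columns and slope \<open>y\<close> through the remaining \<open>k n\<close>,
    about a fraction \<open>t\<close> of all.\<close>
  define k where "k n = nat \<lfloor>t * real n\<rfloor>" for n :: nat
  define j where "j n = n - k n" for n :: nat
  have k_bounds: "real (k n) \<le> t * real n" "t * real n - 1 \<le> real (k n)" for n
    using t by (auto simp: k_def) (linarith+)?
  have k_le: "k n \<le> n" for n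
  proof -
    have "t * real n \<le> 1 * real n" using t by (intro mult_right_mono) auto
    then show ?thesis using k_bounds(1)[of n] by simp
  qed
  have j_real: "real (j n) = real n - real (k n)" for n using k_le[of n] by (simp add: j_def)
  have k_ratio: "(\<lambda>n. real (k n) / real n) \<longlonglongrightarrow> t"
  proof (rule tendsto_sandwich[of "\<lambda>n. t - 1 / real n" _ _ "\<lambda>n. t"])
    show "\<forall>\<^sub>F n in sequentially. t - 1 / real n \<le> real (k n) / real n"
      using eventually_gt_at_top[of 0]
    proof eventually_elim
      case (elim n)
      have "(t * real n - 1) / real n \<le> real (k n) / real n"
        by (intro divide_right_mono k_bounds) simp
      then show ?case using elim by (simp add: diff_divide_distrib)
    qed
    show "\<forall>\<^sub>F n in sequentially. real (k n) / real n \<le> t"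
      using eventually_gt_at_top[of 0]
      by eventually_elim (use k_bounds in \<open>auto simp: field_simps\<close>)
    show "(\<lambda>n. t - 1 / real n) \<longlonglongrightarrow> t"
      using tendsto_diff[OF tendsto_const[of t] lim_1_over_n] by simp
  qed simp
  have "(\<lambda>n. 1 - real (k n) / real n) \<longlonglongrightarrow> 1 - t" by (intro tendsto_diff tendsto_const k_ratio)
  then have j_ratio: "(\<lambda>n. real (j n) / real n) \<longlonglongrightarrow> 1 - t"
    by (rule Lim_transform_eventually)
      (auto simp: j_real diff_divide_distrib intro!: eventually_sequentiallyI[of 1])
  have "filterlim (\<lambda>n. real (k n)) at_top sequentially"
    by (rule filterlim_at_top_mono[of "\<lambda>n. t * real n - 1"]) (use t k_bounds in \<open>real_asymp | simp\<close>)+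
  then have k_lim: "filterlim k at_top sequentially"
    by (simp add: filterlim_sequentially_iff_filterlim_real)
  have "filterlim (\<lambda>n. real (j n)) at_top sequentially"
  proof (rule filterlim_at_top_mono[of "\<lambda>n. (1 - t) * real n"])
    show "filterlim (\<lambda>n. (1 - t) * real n) at_top sequentially" using t by real_asymp
    show "\<forall>\<^sub>F n in sequentially. (1 - t) * real n \<le> real (j n)"
      using k_bounds(1) by (simp add: j_real algebra_simps)
  qed
  then have j_lim: "filterlim j at_top sequentially"
    by (simp add: filterlim_sequentially_iff_filterlim_real)
  let ?e = "\<lambda>v n. mean_crossing_time n \<lceil>v * real n\<rceil>"
  \<comment> \<open>For \<open>i = 0\<close> both sides vanish, since the mean crossing time from
    the origin to itself is 0.\<close>
  have cancel: "?e v i / real i * (real i / real n) = ?e v i / real n" for v i n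
    by (cases "i = 0") auto
  have step: "?e w n / real n \<le> ?e x (j n) / real (j n) * (real (j n) / real n)
      + ?e y (k n) / real (k n) * (real (k n) / real n) + (x + y + 3) / real n" for n
  proof -
    let ?p = "\<lceil>x * real (j n)\<rceil>" and ?q = "\<lceil>y * real (k n)\<rceil>"
    have "w * real n - (x * real (j n) + y * real (k n)) = (y - x) * (t * real n - real (k n))"
      by (simp add: w_def j_real algebra_simps)
    moreover have "\<bar>(y - x) * (t * real n - real (k n))\<bar> \<le> (x + y) * 1"
      unfolding abs_mult using xy k_bounds[of n] by (intro mult_mono) auto
    \<comment> \<open>Rounding \<open>k n\<close> displaces the endpoint by at most x + y; the three
      ceilings are allowed 1 each.\<close>
    ultimately have "\<bar>real_of_int (\<lceil>w * real n\<rceil> - (?p + ?q))\<bar> \<le> x + y + 3"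
      by (simp add: abs_le_iff) linarith
    then have "?e w n \<le> mean_crossing_time n (?p + ?q) + (x + y + 3)"
      using mean_crossing_time_lipschitz[of n "\<lceil>w * real n\<rceil>" "?p + ?q"] by simp
    also have "mean_crossing_time n (?p + ?q) \<le> ?e x (j n) + ?e y (k n)"
      using mean_crossing_time_subadditive[of "j n" "k n" ?p ?q] k_le[of n] by (simp add: j_def)
    finally have "?e w n / real n \<le> (?e x (j n) + ?e y (k n) + (x + y + 3)) / real n"
      by (intro divide_right_mono) auto
    then show ?thesis unfolding cancel by (simp add: add_divide_distrib)
  qed
  have "(\<lambda>n. (x + y + 3) / real n) \<longlonglongrightarrow> 0" by real_asymp
  then have "(\<lambda>n. ?e x (j n) / real (j n) * (real (j n) / real n)
      + ?e y (k n) / real (k n) * (real (k n) / real n) + (x + y + 3) / real n)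
      \<longlonglongrightarrow> time_constant x * (1 - t) + time_constant y * t + 0"
    by (intro tendsto_add tendsto_mult j_ratio k_ratio
        filterlim_compose[OF time_constant_tendsto j_lim] filterlim_compose[OF time_constant_tendsto k_lim])
  from LIMSEQ_le[OF time_constant_tendsto[of w] this] step
  show "time_constant ((1 - t) *\<^sub>R x + t *\<^sub>R y) \<le> (1 - t) * time_constant x + t * time_constant y"
    by (auto simp: w_def mult.commute)
qed simp

section \<open>Convergence of crossing times\<close>

lemma AE_crossing_time_tendsto:
  assumes iid: "iid_weights M \<tau>" and v: "0 \<le> v"
  shows "AE \<omega> in M. (\<lambda>n. crossing_time (shifted \<tau> 0 0 \<omega>) n \<lceil>v * real n\<rceil> / real n) \<longlonglongrightarrow> time_constant v"
proof -
  interpret M: prob_space M using iid by (simp add: iid_weights_def)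
  let ?S = "\<lambda>\<omega> n. crossing_time (shifted \<tau> 0 0 \<omega>) n \<lceil>v * real n\<rceil>"
  let ?e = "\<lambda>n. mean_crossing_time n \<lceil>v * real n\<rceil>"
  define Z where "Z k \<omega> = (?S \<omega> (k\<^sup>2) - ?e (k\<^sup>2)) / real (k\<^sup>2)" for k \<omega>
  have "AE \<omega> in M. (\<lambda>k. Z k \<omega>) \<longlonglongrightarrow> 0"
  proof (rule M.AE_tendsto_zero_of_summable_second_moments)
    fix k
    show "integrable M (\<lambda>\<omega>. (Z k \<omega>)\<^sup>2)"
      unfolding Z_def power_divide by (intro integrable_divide integrable_crossing_time_deviation[OF iid])
    have "M.expectation (\<lambda>\<omega>. (Z k \<omega>)\<^sup>2)
        = M.expectation (\<lambda>\<omega>. (?S \<omega> (k\<^sup>2) - ?e (k\<^sup>2))\<^sup>2) / (real (k\<^sup>2))\<^sup>2"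
      unfolding Z_def power_divide by simp
    also have "\<dots> \<le> real (k\<^sup>2) * second_moment_bound / (real (k\<^sup>2))\<^sup>2"
      by (intro divide_right_mono integral_crossing_time_deviation[OF iid]) auto
    \<comment> \<open>For \<open>k = 0\<close> both sides are 0 by division by zero.\<close>
    also have "\<dots> = second_moment_bound * inverse (real k ^ 2)"
      by (cases "k = 0") (auto simp: field_simps power2_eq_square)
    finally show "M.expectation (\<lambda>\<omega>. (Z k \<omega>)\<^sup>2) \<le> second_moment_bound * inverse (real k ^ 2)" .
  qed (intro summable_mult inverse_power_summable, simp)
  then show ?thesis
  proof (rule AE_mp, intro AE_I2 impI)
    fix \<omega> assume Z: "(\<lambda>k. Z k \<omega>) \<longlonglongrightarrow> 0"
    have sq: "filterlim (\<lambda>k::nat. k\<^sup>2) at_top sequentially"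
      by (rule filterlim_at_top_mono[OF filterlim_ident]) (auto simp: power2_eq_square)
    have "(\<lambda>k. Z k \<omega> + ?e (k\<^sup>2) / real (k\<^sup>2)) \<longlonglongrightarrow> 0 + time_constant v"
      by (intro tendsto_add Z filterlim_compose[OF time_constant_tendsto sq])
    then have "(\<lambda>k. ?S \<omega> (k\<^sup>2) / real (k\<^sup>2)) \<longlonglongrightarrow> time_constant v"
      by (simp add: Z_def diff_divide_distrib)
    then show "(\<lambda>n. ?S \<omega> n / real n) \<longlonglongrightarrow> time_constant v"
    proof (rule tendsto_div_of_tendsto_squares[OF crossing_time_nonneg v, rotated])
      \<comment> \<open>Extra columns never lower the time, so only the rise of the endpoint, at
        most v (n' - n) + 1, can be lost.\<close>
      fix n n' :: nat assume le: "n \<le> n'"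
      have "?S \<omega> n \<le> crossing_time (shifted \<tau> 0 0 \<omega>) n' \<lceil>v * real n\<rceil>"
        by (rule crossing_time_mono[OF le])
      also have "\<dots> \<le> ?S \<omega> n' + real_of_int \<bar>\<lceil>v * real n\<rceil> - \<lceil>v * real n'\<rceil>\<bar>"
        by (rule crossing_time_lipschitz)
      also have "real_of_int \<bar>\<lceil>v * real n\<rceil> - \<lceil>v * real n'\<rceil>\<bar> \<le> v * (real n' - real n) + 1"
      proof -
        have "v * real n \<le> v * real n'" using le v by (intro mult_left_mono) auto
        then have "\<lceil>v * real n\<rceil> \<le> \<lceil>v * real n'\<rceil>" by (rule ceiling_mono)
        then have "real_of_int \<bar>\<lceil>v * real n\<rceil> - \<lceil>v * real n'\<rceil>\<bar>
            = real_of_int \<lceil>v * real n'\<rceil> - real_of_int \<lceil>v * real n\<rceil>" by simp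
        also have "\<dots> \<le> v * real n' - v * real n + 1" by linarith
        finally show ?thesis by (simp add: algebra_simps)
      qed
      finally show "?S \<omega> n \<le> ?S \<omega> n' + v * (real n' - real n) + 1" by simp
    qed
  qed
qed

text \<open>The mean deviation is at most the root of the variance bound, of order sqrt n, so
  dividing by n leaves order 1 / sqrt n. The centring error vanishes by
  \<open>time_constant_tendsto\<close>.\<close>

lemma L1_crossing_time_tendsto:
  assumes iid: "iid_weights M \<tau>"
  shows "(\<lambda>n. \<integral>\<omega>. \<bar>crossing_time (shifted \<tau> 0 0 \<omega>) n \<lceil>v * real n\<rceil> / real n - time_constant v\<bar> \<partial>M) \<longlonglongrightarrow> 0"
proof -
  interpret M: prob_space M using iid by (simp add: iid_weights_def)
  let ?S = "\<lambda>\<omega> n. crossing_time (shifted \<tau> 0 0 \<omega>) n \<lceil>v * real n\<rceil>"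
  let ?e = "\<lambda>n. mean_crossing_time n \<lceil>v * real n\<rceil>"
  let ?K = second_moment_bound
  have upper: "M.expectation (\<lambda>\<omega>. \<bar>?S \<omega> n / real n - time_constant v\<bar>)
      \<le> sqrt (real n * ?K) / real n + \<bar>?e n / real n - time_constant v\<bar>" for n
  proof -
    have "integrable M (\<lambda>\<omega>. ?S \<omega> n)" by (rule integrable_crossing_time_shifted[OF iid])
    then have idev: "integrable M (\<lambda>\<omega>. \<bar>?S \<omega> n - ?e n\<bar>)" and "integrable M (\<lambda>\<omega>. \<bar>?S \<omega> n / real n - time_constant v\<bar>)"
      by (intro integrable_abs Bochner_Integration.integrable_diff integrable_divide M.integrable_const; assumption)+
    have "(M.expectation (\<lambda>\<omega>. \<bar>?S \<omega> n - ?e n\<bar>))\<^sup>2 \<le> M.expectation (\<lambda>\<omega>. \<bar>?S \<omega> n - ?e n\<bar>\<^sup>2)"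
      using integrable_crossing_time_deviation[OF iid, of 0 0 n "\<lceil>v * real n\<rceil>"] idev
      by (intro M.square_lebesgue_integral_le) auto
    also have "\<dots> \<le> real n * ?K"
      using integral_crossing_time_deviation[OF iid, of 0 0 n "\<lceil>v * real n\<rceil>"] by simp
    finally have dev: "M.expectation (\<lambda>\<omega>. \<bar>?S \<omega> n - ?e n\<bar>) \<le> sqrt (real n * ?K)"
      by (rule real_le_rsqrt)
    have "M.expectation (\<lambda>\<omega>. \<bar>?S \<omega> n / real n - time_constant v\<bar>)
        \<le> M.expectation (\<lambda>\<omega>. \<bar>?S \<omega> n - ?e n\<bar> / real n + \<bar>?e n / real n - time_constant v\<bar>)"
    proof (rule integral_mono)
      fix \<omega>
      have "?S \<omega> n / real n - time_constant v
          = (?S \<omega> n - ?e n) / real n + (?e n / real n - time_constant v)"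
        by (simp add: diff_divide_distrib)
      then show "\<bar>?S \<omega> n / real n - time_constant v\<bar>
          \<le> \<bar>?S \<omega> n - ?e n\<bar> / real n + \<bar>?e n / real n - time_constant v\<bar>"
        using abs_triangle_ineq[of "(?S \<omega> n - ?e n) / real n" "?e n / real n - time_constant v"]
        by simp
    qed (use idev \<open>integrable M (\<lambda>\<omega>. \<bar>?S \<omega> n / real n - time_constant v\<bar>)\<close> in simp_all)
    also have "\<dots> = M.expectation (\<lambda>\<omega>. \<bar>?S \<omega> n - ?e n\<bar>) / real n + \<bar>?e n / real n - time_constant v\<bar>"
      using idev by (subst Bochner_Integration.integral_add) (auto simp: M.prob_space)
    also have "\<dots> \<le> sqrt (real n * ?K) / real n + \<bar>?e n / real n - time_constant v\<bar>"
      using dev by (intro add_right_mono divide_right_mono) auto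
    finally show ?thesis .
  qed
  have "(\<lambda>n. sqrt (?K / real n)) \<longlonglongrightarrow> sqrt 0"
    by (intro tendsto_real_sqrt lim_const_over_n)
  moreover have "sqrt (real n * ?K) / real n = sqrt (?K / real n)" for n
    by (cases "n = 0") (auto simp: real_sqrt_mult real_sqrt_divide field_simps)
  ultimately have "(\<lambda>n. sqrt (real n * ?K) / real n) \<longlonglongrightarrow> 0" by simp
  moreover have "(\<lambda>n. \<bar>?e n / real n - time_constant v\<bar>) \<longlonglongrightarrow> 0"
    using time_constant_tendsto[of v] by (simp add: LIM_zero tendsto_rabs_zero)
  ultimately have "(\<lambda>n. sqrt (real n * ?K) / real n + \<bar>?e n / real n - time_constant v\<bar>) \<longlonglongrightarrow> 0"
    using tendsto_add by fastforce
  then show ?thesis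
    by (rule tendsto_sandwich[OF always_eventually always_eventually tendsto_const, rotated 2])
      (use upper in \<open>auto simp del: add_0\<close>)
qed

section \<open>Return to passage times\<close>

lemma AE_passage_time_eq_crossing_time:
  assumes iid: "iid_weights M \<tau>" and "prob {0..} = 1"
  shows "AE \<omega> in M. \<forall>n m. real_of_ereal (passage_time \<tau> \<omega> (0, 0) (int n, m))
           = crossing_time (shifted \<tau> 0 0 \<omega>) n m"
proof -
  note [measurable] = iid_weights_measurable[OF iid]
  have "AE x in G. x \<in> {0..}" using assms(2) by (subst (asm) prob_eq_1) auto
  have "AE \<omega> in M. 0 \<le> \<tau> z \<omega>" for z
  proof -
    have "distr M borel (\<tau> z) = G" using iid by (cases z) (simp add: iid_weights_def)
    then have "AE x in distr M borel (\<tau> z). x \<in> {0..}" using \<open>AE x in G. x \<in> {0..}\<close> by (simp only:)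
    then show ?thesis by (subst (asm) AE_distr_iff) auto
  qed
  \<comment> \<open>There are countably many edges, so one null set serves all endpoints at
    once.\<close>
  then have "AE \<omega> in M. \<forall>z. 0 \<le> \<tau> z \<omega>" unfolding AE_all_countable by blast
  then show ?thesis
  proof (rule AE_mp, intro AE_I2 impI allI)
    fix \<omega> n m assume "\<forall>z. 0 \<le> \<tau> z \<omega>"
    then have "\<And>z. 0 \<le> \<tau> z \<omega>" by blast
    from passage_time_eq_crossing_time[where \<tau> = \<tau> and \<omega> = \<omega>, OF this]
    show "real_of_ereal (passage_time \<tau> \<omega> (0, 0) (int n, m)) = crossing_time (shifted \<tau> 0 0 \<omega>) n m"
      by simp
  qed
qed

text \<open>An infimum over countably many paths. Measurability is checked directly, since almost
  everywhere equality with a crossing time does not give it in an incomplete space.\<close>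

lemma passage_time_measurable:
  assumes "iid_weights M \<tau>"
  shows "(\<lambda>\<omega>. passage_time \<tau> \<omega> u w) \<in> borel_measurable M"
proof -
  note [measurable] = iid_weights_measurable[OF assms]
  have [measurable]: "(\<lambda>\<omega>. path_time \<tau> \<omega> p) \<in> borel_measurable M" for p
    unfolding path_time_def edge_weight_def by measurable
  show ?thesis unfolding passage_time_def by measurable
qed

end

theorem theorem1p1:
  fixes G :: "real measure"
  assumes "prob_space G" and "sets G = sets borel" and "measure G {0..} = 1"
  shows "\<exists>\<Lambda> :: real \<Rightarrow> real. convex_on {0..} \<Lambda> \<and> (\<forall>v\<ge>0. \<Lambda> v \<ge> 0) \<and>
    (\<forall>(M :: 'a measure) (\<tau> :: pt \<Rightarrow> 'a \<Rightarrow> real).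
       prob_space M \<and> prob_space.indep_vars M (\<lambda>_. borel) \<tau> UNIV \<and> (\<forall>z. distr M borel (\<tau> z) = G)
       \<longrightarrow> (\<forall>v::real. v \<ge> 0 \<longrightarrow>
             (AE \<omega> in M. (\<lambda>n::nat. real_of_ereal (passage_time \<tau> \<omega> (0,0) (int n, \<lceil>v * real n\<rceil>)) / real n)
                 \<longlonglongrightarrow> \<Lambda> v) \<and>
             (\<forall>n::nat. integrable M (\<lambda>\<omega>. real_of_ereal (passage_time \<tau> \<omega> (0,0) (int n, \<lceil>v * real n\<rceil>)) / real n)) \<and>
             (\<lambda>n::nat. \<integral>\<omega>. \<bar>real_of_ereal (passage_time \<tau> \<omega> (0,0) (int n, \<lceil>v * real n\<rceil>)) / real n - \<Lambda> v\<bar> \<partial>M)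
                 \<longlonglongrightarrow> 0))"
proof -
  interpret edge_law G using assms by (simp add: edge_law_def edge_law_axioms_def)
  show ?thesis
  proof (intro exI[of _ time_constant] conjI allI impI)
    fix M :: "'a measure" and \<tau> :: "pt \<Rightarrow> 'a \<Rightarrow> real" and v :: real
    assume M: "prob_space M \<and> prob_space.indep_vars M (\<lambda>_. borel) \<tau> UNIV \<and> (\<forall>z. distr M borel (\<tau> z) = G)"
      and v: "0 \<le> v"
    then have iid: "iid_weights M \<tau>" unfolding iid_weights_def by blast
    note eq = AE_passage_time_eq_crossing_time[OF iid assms(3)]
    note [measurable] = passage_time_measurable[OF iid]
    have [measurable]: "(\<lambda>\<omega>. crossing_time (shifted \<tau> 0 0 \<omega>) n m) \<in> borel_measurable M" for n m
      using integrable_crossing_time_shifted[OF iid] by (rule borel_measurable_integrable)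
    show "AE \<omega> in M. (\<lambda>n. real_of_ereal (passage_time \<tau> \<omega> (0,0) (int n, \<lceil>v * real n\<rceil>)) / real n)
        \<longlonglongrightarrow> time_constant v"
      using AE_crossing_time_tendsto[OF iid v] eq by eventually_elim simp
    show "integrable M (\<lambda>\<omega>. real_of_ereal (passage_time \<tau> \<omega> (0,0) (int n, \<lceil>v * real n\<rceil>)) / real n)" for n
    proof (rule integrable_cong_AE_imp)
      show "integrable M (\<lambda>\<omega>. crossing_time (shifted \<tau> 0 0 \<omega>) n \<lceil>v * real n\<rceil> / real n)"
        by (intro integrable_divide integrable_crossing_time_shifted[OF iid])
      show "AE \<omega> in M. crossing_time (shifted \<tau> 0 0 \<omega>) n \<lceil>v * real n\<rceil> / real n
          = real_of_ereal (passage_time \<tau> \<omega> (0,0) (int n, \<lceil>v * real n\<rceil>)) / real n"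
        using eq by eventually_elim simp
    qed measurable
    have "(\<integral>\<omega>. \<bar>real_of_ereal (passage_time \<tau> \<omega> (0,0) (int n, \<lceil>v * real n\<rceil>)) / real n - time_constant v\<bar> \<partial>M)
        = (\<integral>\<omega>. \<bar>crossing_time (shifted \<tau> 0 0 \<omega>) n \<lceil>v * real n\<rceil> / real n - time_constant v\<bar> \<partial>M)" for n
    proof (rule integral_cong_AE)
      show "AE \<omega> in M. \<bar>real_of_ereal (passage_time \<tau> \<omega> (0,0) (int n, \<lceil>v * real n\<rceil>)) / real n - time_constant v\<bar>
          = \<bar>crossing_time (shifted \<tau> 0 0 \<omega>) n \<lceil>v * real n\<rceil> / real n - time_constant v\<bar>"
        using eq by eventually_elim simp
    qed measurable
    then show "(\<lambda>n. \<integral>\<omega>. \<bar>real_of_ereal (passage_time \<tau> \<omega> (0,0) (int n, \<lceil>v * real n\<rceil>)) / real n - time_constant v\<bar> \<partial>M)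
        \<longlonglongrightarrow> 0"
      using L1_crossing_time_tendsto[OF iid, of v] by simp
  qed (auto simp: convex_time_constant time_constant_nonneg)
qed

end
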